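(* Let $(\mathfrak g,(\cdot,\cdot),\mathfrak h)$ be an extended affine Lie algebra, $\sigma$ an automorphism of $\mathfrak g$ satisfying conditions (C1)--(C5) of the context, $\mathcal A$ a quantum torus based on a free abelian group $\Lambda$ of finite rank, and $\rho:\Lambda\to\mathbb Z_m$ a group epimorphism. Assume that $\mathfrak g$ admits a $\sigma$-Chevalley pair $(\tau,\psi)$. Then the assignment $$x\otimes a^\lambda+\gamma+d\ \mapsto\ \psi\tau(x)\otimes a^{-\lambda}-\gamma-d\qquad (x\in\mathfrak g,\ \lambda\in\Lambda,\ \gamma\in\mathcal V,\ d\in\mathcal V^\star)$$ (so in particular $\pi_\lambda(x)\otimes a^\lambda+\gamma+d\mapsto\psi\tau(\pi_\lambda(x))\otimes a^{-\lambda}-\gamma-d$) defines an automorphism $\bar\tau_\psi$ of $\hat L(\mathfrak g,\mathcal A)$ which restricts to a Chevalley automorphism of $\hat L_\rho(\mathfrak g,\mathcal A)$.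
   Context: All algebras are over $\mathbb C$. Extended affine Lie algebra (EALA): a triple $(\mathfrak g,(\cdot,\cdot),\mathfrak h)$ with $\mathfrak g$ a Lie algebra, $\mathfrak h$ a non-trivial subalgebra, $(\cdot,\cdot)$ a symmetric bilinear form on $\mathfrak g$ such that: (A1) the form is invariant and non-degenerate; (A2) $\mathfrak h$ is finite-dimensional and $\mathfrak g=\sum_{\alpha\in\mathfrak h^\star}\mathfrak g_\alpha$, $\mathfrak g_\alpha=\{x\mid [h,x]=\alpha(h)x\ \forall h\in\mathfrak h\}$, $\mathfrak g_0=\mathfrak h$; let $R=\{\alpha\mid\mathfrak g_\alpha\ne0\}$ (root system), transfer the form to $\mathfrak h^\star$ by $(\alpha,\beta)=(t_\alpha,t_\beta)$ where $\alpha(h)=(h,t_\alpha)$, let $R^0=\{\alpha\in R\mid(\alpha,\alpha)=0\}$, $R^\times=R\setminus R^0$; (A3) for $\alpha\in R^\times$, $x\in\mathfrak g_\alpha$, $\mathrm{ad}(x)$ is locally nilpotent; (A4) the $\mathbb Z$-span of $R$ is free abelian of rank $\dim_{\mathbb R}\mathrm{span}_{\mathbb R}R$; (A5) $R^\times$ is indecomposable (not a union of two non-empty orthogonal subsets), and $R^0=(R^\times-R^\times)\cap V^0$, $V^0$ the radical of the form on $\mathrm{span}_{\mathbb R}R$. Quantum torus: $\mathcal A=\bigoplus_{\lambda\in\Lambda}\mathbb C a^\lambda$, $\mathcal A^\lambda=\mathbb Ca^\lambda$, $a^\lambda a^\gamma=\mu(\lambda,\gamma)a^{\lambda+\gamma}$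 with $\mu:\Lambda\times\Lambda\to\mathbb C^\times$ a 2-cocycle satisfying $\mu(\lambda,\tau)=\mu(\tau,\lambda)=\mu(-\lambda,-\tau)$ and $\mu(0,0)=1$; form $\epsilon(a^\lambda,a^\tau)=\mu(\lambda,\tau)\delta_{\lambda,-\tau}$. Conditions on $\sigma\in\mathrm{Aut}(\mathfrak g)$: (C1) $\sigma^m=\mathrm{id}$; (C2) $\sigma(\mathfrak h)=\mathfrak h$; (C3) $(\sigma(x),\sigma(y))=(x,y)$; (C4) $C_{\mathfrak g^\sigma}(\mathfrak h^\sigma)\subseteq\mathfrak h^\sigma$; (C5) $(\alpha,\pi(\alpha))\ne0$ for some $\alpha\in R$. Here $\mathfrak g^\sigma,\mathfrak h^\sigma$ denote fixed points, $\sigma$ acts on $\mathfrak h^\star$ by $\sigma(\alpha)(h)=\alpha(\sigma^{-1}(h))$ and $\pi=\frac1m\sum_{i=0}^{m-1}\sigma^i$. With $\omega=e^{2\pi i/m}$, $\mathfrak g^{\bar j}=\{x\mid\sigma(x)=\omega^jx\}$ and $\pi_j=\frac1m\sum_{i=0}^{m-1}\omega^{-ij}\sigma^i$ is the projection onto $\mathfrak g^{\bar j}$; $\mathfrak h^{\bar 0}=\mathfrak h^\sigma$. For $\lambda\in\Lambda$, $\bar\lambda=\rho(\lambda)$, and $\pi_\lambda$ is the projection onto $\mathfrak g^{\bar\lambda}$. Affinization: $L(\mathfrak g,\mathcal A)=\mathfrak g\otimes\mathcal A$ with $[x\otimes a,y\otimes b]=[x,y]\otimes ab$ and form $(x\otimes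 a,y\otimes b)=(x,y)\epsilon(a,b)$; $L_\rho(\mathfrak g,\mathcal A)=\bigoplus_{\lambda}\mathfrak g^{\bar\lambda}\otimes\mathcal A^\lambda$. Let $\mathcal V=\mathbb C\otimes_{\mathbb Z}\Lambda\supseteq\Lambda$. $\hat L_\rho(\mathfrak g,\mathcal A)=L_\rho(\mathfrak g,\mathcal A)\oplus\mathcal V\oplus\mathcal V^\star$ with bracket: $[d,x]=d(\lambda)x$ for $d\in\mathcal V^\star$, $x$ of degree $\lambda$; $\mathcal V$ central; $[\mathcal V^\star,\mathcal V^\star]=0$; $[x,y]=[x,y]_{L_\rho}+(x,y)\lambda$ for $x$ of degree $\lambda$. The form is extended by $(\mathcal V,\mathcal V)=(\mathcal V^\star,\mathcal V^\star)=(\mathcal V\oplus\mathcal V^\star,L_\rho)=0$, $(v,d)=(d,v)=d(v)$. With $\hat{\mathfrak h}=(\mathfrak h^\sigma\otimes1)\oplus\mathcal V\oplus\mathcal V^\star$, $(\hat L_\rho(\mathfrak g,\mathcal A),(\cdot,\cdot),\hat{\mathfrak h})$ is an EALA. $\hat L(\mathfrak g,\mathcal A)=(\mathfrak g\otimes\mathcal A)\oplus\mathcal V\oplus\mathcal V^\star$ is the case $\sigma=\mathrm{id}$, $\rho=0$; it contains $\hat L_\rho(\mathfrak g,\mathcal A)$. Chevalley automorphism of an EALA $(\mathfrak g,(\cdot,\cdot),\mathfrak h)$: a finite order automorphism $\tau$ with $\tau(h)=-h$ for all $h\in\mathfrak h$. A $\sigma$-Chevalley pair is a pair $(\tau,\psi)$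 of finite order automorphisms of $\mathfrak g$ such that $\tau$ is a Chevalley automorphism, $\sigma\tau=\tau\sigma$, $\psi(\mathfrak g^{\bar j})=\mathfrak g^{-\bar j}$ for $j=0,\dots,m-1$, $\psi$ preserves the form, and $\psi(h)=h$ for $h\in\mathfrak h^{\bar0}$.
   Formalization: The finite-order part of "Chevalley automorphism" fails in general, since ψτ can have infinite order when g is not tame. The automorphism, its restriction and −1 on ĥ are proved unconditionally; the restriction is proved to be Chevalley if and only if ψτ has finite order on g. *)

theory Defs
  imports
    Complex_Main
    "HOL-Library.Poly_Mapping"
    "HOL-Library.Product_Plus"
    "HOL-Library.Function_Algebras"
begin

section \<open>Complex Lie algebras\<close>

text \<open>
  A Lie algebra is a linear subspace \<open>L\<close> of an ambient complex vector space together with an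
  operation on the ambient type that is only constrained on \<open>L\<close>. Maps between Lie algebras are
  likewise only constrained on the carriers.
\<close>

locale lie_algebra = vector_space scale
  for scale :: "complex \<Rightarrow> 'a::ab_group_add \<Rightarrow> 'a" +
  fixes L :: "'a set" and br :: "'a \<Rightarrow> 'a \<Rightarrow> 'a"
  assumes subspace_carrier: "subspace L"
    and br_closed: "x \<in> L \<Longrightarrow> y \<in> L \<Longrightarrow> br x y \<in> L"
    and br_add_left: "x \<in> L \<Longrightarrow> y \<in> L \<Longrightarrow> z \<in> L \<Longrightarrow> br (x + y) z = br x z + br y z"
    and br_add_right: "x \<in> L \<Longrightarrow> y \<in> L \<Longrightarrow> z \<in> L \<Longrightarrow> br x (y + z) = br x y + br x z"
    and br_scale_left: "x \<in> L \<Longrightarrow> y \<in> L \<Longrightarrow> br (scale c x) y = scale c (br x y)"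
    and br_scale_right: "x \<in> L \<Longrightarrow> y \<in> L \<Longrightarrow> br x (scale c y) = scale c (br x y)"
    and br_self: "x \<in> L \<Longrightarrow> br x x = 0"
    and jacobi: "x \<in> L \<Longrightarrow> y \<in> L \<Longrightarrow> z \<in> L \<Longrightarrow>
      br x (br y z) + br y (br z x) + br z (br x y) = 0"

definition lie_automorphism ::
  "(complex \<Rightarrow> 'a::ab_group_add \<Rightarrow> 'a) \<Rightarrow> 'a set \<Rightarrow> ('a \<Rightarrow> 'a \<Rightarrow> 'a) \<Rightarrow> ('a \<Rightarrow> 'a) \<Rightarrow> bool"
  where "lie_automorphism scale L br f \<longleftrightarrow>
    bij_betw f L L \<and>
    (\<forall>x\<in>L. \<forall>y\<in>L. f (x + y) = f x + f y) \<and>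
    (\<forall>c. \<forall>x\<in>L. f (scale c x) = scale c (f x)) \<and>
    (\<forall>x\<in>L. \<forall>y\<in>L. f (br x y) = br (f x) (f y))"

definition finite_order_on :: "'a set \<Rightarrow> ('a \<Rightarrow> 'a) \<Rightarrow> bool"
  where "finite_order_on L f \<longleftrightarrow> (\<exists>k>0. \<forall>x\<in>L. (f ^^ k) x = x)"

definition fixed_points :: "'a set \<Rightarrow> ('a \<Rightarrow> 'a) \<Rightarrow> 'a set"
  where "fixed_points S f = {x \<in> S. f x = x}"

text \<open>
  Functionals on a subspace \<open>h\<close> are normalised to vanish outside \<open>h\<close>. Hence two of them agree on
  \<open>h\<close> iff they are equal as functions, and the dual space is closed under the pointwise operations.
\<close>

definition dual :: "(complex \<Rightarrow> 'a::ab_group_add \<Rightarrow> 'a) \<Rightarrow> 'a set \<Rightarrow> ('a \<Rightarrow> complex) set"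
  where "dual scale h = {\<alpha>.
    (\<forall>x\<in>h. \<forall>y\<in>h. \<alpha> (x + y) = \<alpha> x + \<alpha> y) \<and>
    (\<forall>c. \<forall>x\<in>h. \<alpha> (scale c x) = c * \<alpha> x) \<and>
    (\<forall>x. x \<notin> h \<longrightarrow> \<alpha> x = 0)}"


section \<open>Integral and real spans\<close>

definition zscale :: "int \<Rightarrow> 'a::ab_group_add \<Rightarrow> 'a"
  where "zscale n x = (if 0 \<le> n then \<Sum>i<nat n. x else - (\<Sum>i<nat (- n). x))"

lemma zscale_of_nat: "zscale (int n) x = (\<Sum>i<n. x)"
  by (simp add: zscale_def)

lemma zscale_0 [simp]: "zscale 0 x = 0"
  by (simp add: zscale_def)

lemma zscale_minus: "zscale (- n) x = - zscale n x"
  by (auto simp: zscale_def)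

lemma zscale_of_nat_diff: "zscale (int a - int b) x = zscale (int a) x - zscale (int b) x"
proof -
  have nat_add: "zscale (int (p + q)) x = zscale (int p) x + zscale (int q) x" for p q
    unfolding zscale_of_nat by (induction q) (simp_all add: add_ac)
  show ?thesis
  proof (cases "b \<le> a")
    case True
    then show ?thesis using nat_add[of "a - b" b] by (simp add: of_nat_diff)
  next
    case False
    then have "int a - int b = - int (b - a)" by (simp add: of_nat_diff)
    with False show ?thesis using nat_add[of "b - a" a]
      by (simp only: zscale_minus) (simp add: of_nat_diff)
  qed
qed

lemma zscale_add_left: "zscale (a + b) x = zscale a x + zscale b x"
proof -
  obtain p q where a: "a = int p - int q" by (metis int_diff_cases)
  obtain r s where b: "b = int r - int s" by (metis int_diff_cases)
  have "a + b = int (p + r) - int (q + s)" using a b by simp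
  moreover have "zscale (int (u + v)) x = zscale (int u) x + zscale (int v) x" for u v
    unfolding zscale_of_nat by (induction v) (simp_all add: add_ac)
  ultimately show ?thesis using a b
    by (simp only: zscale_of_nat_diff) (simp add: algebra_simps)
qed

lemma zscale_add_right: "zscale a (x + y) = zscale a x + zscale a y"
  by (simp add: zscale_def sum.distrib)

lemma zscale_mult: "zscale a (zscale b x) = zscale (a * b) x"
proof -
  have n: "zscale (int k) (zscale b x) = zscale (int k * b) x" for k
  proof (induction k)
    case (Suc k)
    have "zscale (int (Suc k)) (zscale b x) = zscale b x + zscale (int k) (zscale b x)"
      using zscale_add_left[of 1 "int k" "zscale b x"] by (simp add: zscale_def)
    also have "\<dots> = zscale (b + int k * b) x" by (simp add: Suc zscale_add_left)
    finally show ?case by (simp add: algebra_simps)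
  qed simp
  show ?thesis
  proof (cases a)
    case (neg k)
    then show ?thesis
      using n[of "Suc k"] zscale_minus[of "int (Suc k)" "zscale b x"]
        zscale_minus[of "int (Suc k) * b" x] by (metis mult_minus_left)
  qed (simp add: n)
qed

global_interpretation zmod: module zscale
  by unfold_locales (auto simp: zscale_add_right zscale_add_left zscale_mult, simp add: zscale_def)

definition free_abelian_of_rank :: "'a::ab_group_add set \<Rightarrow> nat \<Rightarrow> bool"
  where "free_abelian_of_rank S n \<longleftrightarrow>
    (\<exists>B. finite B \<and> card B = n \<and> zmod.independent B \<and> zmod.span B = S)"

definition rscale :: "real \<Rightarrow> ('a \<Rightarrow> complex) \<Rightarrow> 'a \<Rightarrow> complex"
  where "rscale r \<alpha> = (\<lambda>x. complex_of_real r * \<alpha> x)"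

global_interpretation rvec: vector_space rscale
  by unfold_locales (auto simp: rscale_def fun_eq_iff algebra_simps)


section \<open>Extended affine Lie algebras\<close>

definition root_space ::
  "(complex \<Rightarrow> 'a::ab_group_add \<Rightarrow> 'a) \<Rightarrow> 'a set \<Rightarrow> ('a \<Rightarrow> 'a \<Rightarrow> 'a) \<Rightarrow> 'a set \<Rightarrow> ('a \<Rightarrow> complex) \<Rightarrow> 'a set"
  where "root_space scale g br h \<alpha> = {x \<in> g. \<forall>k\<in>h. br k x = scale (\<alpha> k) x}"

definition roots ::
  "(complex \<Rightarrow> 'a::ab_group_add \<Rightarrow> 'a) \<Rightarrow> 'a set \<Rightarrow> ('a \<Rightarrow> 'a \<Rightarrow> 'a) \<Rightarrow> 'a set \<Rightarrow> ('a \<Rightarrow> complex) set"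
  where "roots scale g br h = {\<alpha> \<in> dual scale h. root_space scale g br h \<alpha> \<noteq> {0}}"

text \<open>\<open>dual_vec form h \<alpha>\<close> is the vector \<open>t\<^sub>\<alpha>\<close> of \<open>h\<close> representing \<open>\<alpha>\<close>.\<close>

definition dual_vec :: "('a \<Rightarrow> 'a \<Rightarrow> complex) \<Rightarrow> 'a set \<Rightarrow> ('a \<Rightarrow> complex) \<Rightarrow> 'a"
  where "dual_vec form h \<alpha> = (THE t. t \<in> h \<and> (\<forall>k\<in>h. \<alpha> k = form k t))"

definition dual_form ::
  "('a \<Rightarrow> 'a \<Rightarrow> complex) \<Rightarrow> 'a set \<Rightarrow> ('a \<Rightarrow> complex) \<Rightarrow> ('a \<Rightarrow> complex) \<Rightarrow> complex"
  where "dual_form form h \<alpha> \<beta> = form (dual_vec form h \<alpha>) (dual_vec form h \<beta>)"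

definition isotropic_roots ::
  "(complex \<Rightarrow> 'a::ab_group_add \<Rightarrow> 'a) \<Rightarrow> 'a set \<Rightarrow> ('a \<Rightarrow> 'a \<Rightarrow> 'a) \<Rightarrow> ('a \<Rightarrow> 'a \<Rightarrow> complex) \<Rightarrow> 'a set
    \<Rightarrow> ('a \<Rightarrow> complex) set"
  where "isotropic_roots scale g br form h =
    {\<alpha> \<in> roots scale g br h. dual_form form h \<alpha> \<alpha> = 0}"

definition nonisotropic_roots ::
  "(complex \<Rightarrow> 'a::ab_group_add \<Rightarrow> 'a) \<Rightarrow> 'a set \<Rightarrow> ('a \<Rightarrow> 'a \<Rightarrow> 'a) \<Rightarrow> ('a \<Rightarrow> 'a \<Rightarrow> complex) \<Rightarrow> 'a set
    \<Rightarrow> ('a \<Rightarrow> complex) set"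
  where "nonisotropic_roots scale g br form h =
    roots scale g br h - isotropic_roots scale g br form h"

definition root_radical ::
  "(complex \<Rightarrow> 'a::ab_group_add \<Rightarrow> 'a) \<Rightarrow> 'a set \<Rightarrow> ('a \<Rightarrow> 'a \<Rightarrow> 'a) \<Rightarrow> ('a \<Rightarrow> 'a \<Rightarrow> complex) \<Rightarrow> 'a set
    \<Rightarrow> ('a \<Rightarrow> complex) set"
  where "root_radical scale g br form h =
    {\<alpha> \<in> rvec.span (roots scale g br h).
      \<forall>\<beta> \<in> rvec.span (roots scale g br h). dual_form form h \<alpha> \<beta> = 0}"

locale eala = lie_algebra scale g br
  for scale :: "complex \<Rightarrow> 'a::ab_group_add \<Rightarrow> 'a" and g br +
  fixes form :: "'a \<Rightarrow> 'a \<Rightarrow> complex" and h :: "'a set"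
  assumes form_add: "x \<in> g \<Longrightarrow> y \<in> g \<Longrightarrow> z \<in> g \<Longrightarrow> form (x + y) z = form x z + form y z"
    and form_scale: "x \<in> g \<Longrightarrow> y \<in> g \<Longrightarrow> form (scale c x) y = c * form x y"
    and form_sym: "x \<in> g \<Longrightarrow> y \<in> g \<Longrightarrow> form x y = form y x"
    and h_subset: "h \<subseteq> g"
    and h_subspace: "subspace h"
    and h_closed: "x \<in> h \<Longrightarrow> y \<in> h \<Longrightarrow> br x y \<in> h"
    and h_nontrivial: "h \<noteq> {0}"
    and A1_invariant: "x \<in> g \<Longrightarrow> y \<in> g \<Longrightarrow> z \<in> g \<Longrightarrow> form (br x y) z = form x (br y z)"
    and A1_nondegenerate: "x \<in> g \<Longrightarrow> (\<And>y. y \<in> g \<Longrightarrow> form x y = 0) \<Longrightarrow> x = 0"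
    and A2_finite_dim: "\<exists>B. finite B \<and> span B = h"
    and A2_decomposition: "span (\<Union>\<alpha>\<in>dual scale h. root_space scale g br h \<alpha>) = g"
    and A2_zero: "root_space scale g br h 0 = h"
    and A3: "\<alpha> \<in> nonisotropic_roots scale g br form h \<Longrightarrow> x \<in> root_space scale g br h \<alpha> \<Longrightarrow>
      y \<in> g \<Longrightarrow> \<exists>n. (br x ^^ n) y = 0"
    and A4: "free_abelian_of_rank (zmod.span (roots scale g br h)) (rvec.dim (roots scale g br h))"
    and A5_indecomposable: "\<not> (\<exists>R1 R2. R1 \<noteq> {} \<and> R2 \<noteq> {} \<and>
      nonisotropic_roots scale g br form h = R1 \<union> R2 \<and>
      (\<forall>\<alpha>\<in>R1. \<forall>\<beta>\<in>R2. dual_form form h \<alpha> \<beta> = 0))"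
    and A5_isotropic: "isotropic_roots scale g br form h =
      {\<alpha> - \<beta> |\<alpha> \<beta>. \<alpha> \<in> nonisotropic_roots scale g br form h \<and>
                   \<beta> \<in> nonisotropic_roots scale g br form h}
      \<inter> root_radical scale g br form h"

text \<open>
  Being a Chevalley automorphism only involves the Lie algebra and the subalgebra \<open>h\<close>, not the form;
  that the data form an extended affine Lie algebra is not part of the predicate.
\<close>

definition chevalley_automorphism ::
  "(complex \<Rightarrow> 'a::ab_group_add \<Rightarrow> 'a) \<Rightarrow> 'a set \<Rightarrow> ('a \<Rightarrow> 'a \<Rightarrow> 'a) \<Rightarrow> 'a set \<Rightarrow> ('a \<Rightarrow> 'a) \<Rightarrow> bool"
  where "chevalley_automorphism scale g br h \<tau> \<longleftrightarrow>
    lie_automorphism scale g br \<tau> \<and> finite_order_on g \<tau> \<and> (\<forall>k\<in>h. \<tau> k = - k)"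


section \<open>Finite order automorphisms\<close>

text \<open>
  Residue classes modulo \<open>m\<close> are given by integer representatives; \<open>eigenspace\<close> depends only on
  \<open>j\<close> modulo \<open>m\<close>.
\<close>

definition eigenspace ::
  "(complex \<Rightarrow> 'a::ab_group_add \<Rightarrow> 'a) \<Rightarrow> 'a set \<Rightarrow> ('a \<Rightarrow> 'a) \<Rightarrow> nat \<Rightarrow> int \<Rightarrow> 'a set"
  where "eigenspace scale g \<sigma> m j =
    {x \<in> g. \<sigma> x = scale (exp (2 * of_real pi * \<i> / of_nat m) powi j) x}"

definition dual_action :: "'a set \<Rightarrow> 'a set \<Rightarrow> ('a \<Rightarrow> 'a) \<Rightarrow> ('a \<Rightarrow> complex) \<Rightarrow> 'a \<Rightarrow> complex"
  where "dual_action g h \<sigma> \<alpha> = (\<lambda>k. if k \<in> h then \<alpha> (inv_into g \<sigma> k) else 0)"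

definition dual_projection :: "'a set \<Rightarrow> 'a set \<Rightarrow> ('a \<Rightarrow> 'a) \<Rightarrow> nat \<Rightarrow> ('a \<Rightarrow> complex) \<Rightarrow> 'a \<Rightarrow> complex"
  where "dual_projection g h \<sigma> m \<alpha> =
    (\<lambda>k. (1 / of_nat m) * (\<Sum>i<m. (dual_action g h \<sigma> ^^ i) \<alpha> k))"

locale eala_automorphism = eala scale g br form h
  for scale :: "complex \<Rightarrow> 'a::ab_group_add \<Rightarrow> 'a" and g br form h +
  fixes \<sigma> :: "'a \<Rightarrow> 'a" and m :: nat
  assumes m_pos: "0 < m"
    and automorphism: "lie_automorphism scale g br \<sigma>"
    and C1: "x \<in> g \<Longrightarrow> (\<sigma> ^^ m) x = x"
    and C2: "\<sigma> ` h = h"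
    and C3: "x \<in> g \<Longrightarrow> y \<in> g \<Longrightarrow> form (\<sigma> x) (\<sigma> y) = form x y"
    and C4: "{x \<in> fixed_points g \<sigma>. \<forall>k \<in> fixed_points h \<sigma>. br x k = 0} \<subseteq> fixed_points h \<sigma>"
    and C5: "\<exists>\<alpha> \<in> roots scale g br h. dual_form form h \<alpha> (dual_projection g h \<sigma> m \<alpha>) \<noteq> 0"

text \<open>
  The two members of a pair are not required to commute, and their composition need not have finite
  order: if \<open>g\<close> is not tame, \<open>\<tau>\<close> and \<open>\<psi>\<close> can act on a root space of an isotropic root, outside
  the core, by fairly arbitrary matrices.
\<close>

definition sigma_chevalley_pair ::
  "(complex \<Rightarrow> 'a::ab_group_add \<Rightarrow> 'a) \<Rightarrow> 'a set \<Rightarrow> ('a \<Rightarrow> 'a \<Rightarrow> 'a) \<Rightarrow> ('a \<Rightarrow> 'a \<Rightarrow> complex) \<Rightarrow> 'a set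
    \<Rightarrow> ('a \<Rightarrow> 'a) \<Rightarrow> nat \<Rightarrow> ('a \<Rightarrow> 'a) \<Rightarrow> ('a \<Rightarrow> 'a) \<Rightarrow> bool"
  where "sigma_chevalley_pair scale g br form h \<sigma> m \<tau> \<psi> \<longleftrightarrow>
    chevalley_automorphism scale g br h \<tau> \<and>
    lie_automorphism scale g br \<psi> \<and> finite_order_on g \<psi> \<and>
    (\<forall>x\<in>g. \<sigma> (\<tau> x) = \<tau> (\<sigma> x)) \<and>
    (\<forall>j\<in>{0..<int m}. \<psi> ` eigenspace scale g \<sigma> m j = eigenspace scale g \<sigma> m (- j)) \<and>
    (\<forall>x\<in>g. \<forall>y\<in>g. form (\<psi> x) (\<psi> y) = form x y) \<and>
    (\<forall>k \<in> fixed_points h \<sigma>. \<psi> k = k)"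


section \<open>Quantum tori\<close>

text \<open>
  The grading group is the whole type \<open>'l\<close>. The quantum torus is the space \<open>'l \<Rightarrow>\<^sub>0 complex\<close> of
  finitely supported functions, with \<open>a\<^sup>\<nu> = single \<nu> 1\<close>; it is determined by \<open>\<mu>\<close>.
\<close>

locale quantum_torus =
  fixes \<mu> :: "'l::ab_group_add \<Rightarrow> 'l \<Rightarrow> complex"
  assumes free_finite_rank: "\<exists>n. free_abelian_of_rank (UNIV :: 'l set) n"
    and nonzero: "\<mu> \<nu> \<gamma> \<noteq> 0"
    and cocycle: "\<mu> \<nu> \<gamma> * \<mu> (\<nu> + \<gamma>) \<kappa> = \<mu> \<gamma> \<kappa> * \<mu> \<nu> (\<gamma> + \<kappa>)"
    and symmetric: "\<mu> \<nu> \<gamma> = \<mu> \<gamma> \<nu>"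
    and minus: "\<mu> \<nu> \<gamma> = \<mu> (- \<nu>) (- \<gamma>)"
    and zero: "\<mu> 0 0 = 1"

definition qt_mult :: "('l::ab_group_add \<Rightarrow> 'l \<Rightarrow> complex) \<Rightarrow> ('l \<Rightarrow>\<^sub>0 complex) \<Rightarrow> ('l \<Rightarrow>\<^sub>0 complex) \<Rightarrow> 'l \<Rightarrow>\<^sub>0 complex"
  where "qt_mult \<mu> a b = (\<Sum>\<nu>\<in>Poly_Mapping.keys a. \<Sum>\<gamma>\<in>Poly_Mapping.keys b.
    Poly_Mapping.single (\<nu> + \<gamma>)
      (\<mu> \<nu> \<gamma> * (Poly_Mapping.lookup a \<nu> * Poly_Mapping.lookup b \<gamma>)))"

definition qt_eps :: "('l::ab_group_add \<Rightarrow> 'l \<Rightarrow> complex) \<Rightarrow> 'l \<Rightarrow> 'l \<Rightarrow> complex"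
  where "qt_eps \<mu> \<nu> \<gamma> = (if \<nu> = - \<gamma> then \<mu> \<nu> \<gamma> else 0)"

definition qt_form :: "('l::ab_group_add \<Rightarrow> 'l \<Rightarrow> complex) \<Rightarrow> ('l \<Rightarrow>\<^sub>0 complex) \<Rightarrow> ('l \<Rightarrow>\<^sub>0 complex) \<Rightarrow> complex"
  where "qt_form \<mu> a b = (\<Sum>\<nu>\<in>Poly_Mapping.keys a. \<Sum>\<gamma>\<in>Poly_Mapping.keys b.
    Poly_Mapping.lookup a \<nu> * Poly_Mapping.lookup b \<gamma> * qt_eps \<mu> \<nu> \<gamma>)"

text \<open>The cyclic group of order \<open>m\<close> is \<open>{0..<m}\<close> with addition modulo \<open>m\<close>.\<close>

definition residue_epimorphism :: "nat \<Rightarrow> ('l::ab_group_add \<Rightarrow> int) \<Rightarrow> bool"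
  where "residue_epimorphism m \<rho> \<longleftrightarrow>
    (\<forall>\<nu> \<gamma>. \<rho> (\<nu> + \<gamma>) = (\<rho> \<nu> + \<rho> \<gamma>) mod int m) \<and> range \<rho> = {0..<int m}"

text \<open>
  \<open>\<iota> : \<Lambda> \<rightarrow> V\<close> exhibits the complex vector space \<open>V\<close> (a whole type) as the scalar extension of
  \<open>\<Lambda>\<close> from the integers to the complex numbers: some integral basis of \<open>\<Lambda>\<close> becomes a complex
  basis of \<open>V\<close>.
\<close>

definition complexification :: "(complex \<Rightarrow> 'v::ab_group_add \<Rightarrow> 'v) \<Rightarrow> ('l::ab_group_add \<Rightarrow> 'v) \<Rightarrow> bool"
  where "complexification scaleV \<iota> \<longleftrightarrow>
    vector_space scaleV \<and> (\<forall>\<nu> \<gamma>. \<iota> (\<nu> + \<gamma>) = \<iota> \<nu> + \<iota> \<gamma>) \<and>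
    (\<exists>B. finite B \<and> zmod.independent B \<and> zmod.span B = UNIV \<and> inj_on \<iota> B \<and>
      \<not> module.dependent scaleV (\<iota> ` B) \<and> module.span scaleV (\<iota> ` B) = UNIV)"


section \<open>Affinization\<close>

text \<open>
  Elements of \<open>g \<otimes> A\<close> are finitely supported functions from the grading group to \<open>g\<close>;
  \<open>single \<nu> x\<close> is \<open>x \<otimes> a\<^sup>\<nu>\<close>.
\<close>

definition tensor :: "(complex \<Rightarrow> 'g::ab_group_add \<Rightarrow> 'g) \<Rightarrow> 'g \<Rightarrow> ('l \<Rightarrow>\<^sub>0 complex) \<Rightarrow> 'l \<Rightarrow>\<^sub>0 'g"
  where "tensor scale x a = (\<Sum>\<nu>\<in>Poly_Mapping.keys a.
    Poly_Mapping.single \<nu> (scale (Poly_Mapping.lookup a \<nu>) x))"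

definition loop_bracket ::
  "(complex \<Rightarrow> 'g::ab_group_add \<Rightarrow> 'g) \<Rightarrow> ('g \<Rightarrow> 'g \<Rightarrow> 'g) \<Rightarrow> ('l::ab_group_add \<Rightarrow> 'l \<Rightarrow> complex)
    \<Rightarrow> ('l \<Rightarrow>\<^sub>0 'g) \<Rightarrow> ('l \<Rightarrow>\<^sub>0 'g) \<Rightarrow> 'l \<Rightarrow>\<^sub>0 'g"
  where "loop_bracket scale br \<mu> p q = (\<Sum>\<nu>\<in>Poly_Mapping.keys p. \<Sum>\<gamma>\<in>Poly_Mapping.keys q.
    Poly_Mapping.single (\<nu> + \<gamma>)
      (scale (\<mu> \<nu> \<gamma>) (br (Poly_Mapping.lookup p \<nu>) (Poly_Mapping.lookup q \<gamma>))))"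

definition loop_form ::
  "('g::ab_group_add \<Rightarrow> 'g \<Rightarrow> complex) \<Rightarrow> ('l::ab_group_add \<Rightarrow> 'l \<Rightarrow> complex)
    \<Rightarrow> ('l \<Rightarrow>\<^sub>0 'g) \<Rightarrow> ('l \<Rightarrow>\<^sub>0 'g) \<Rightarrow> complex"
  where "loop_form form \<mu> p q = (\<Sum>\<nu>\<in>Poly_Mapping.keys p. \<Sum>\<gamma>\<in>Poly_Mapping.keys q.
    form (Poly_Mapping.lookup p \<nu>) (Poly_Mapping.lookup q \<gamma>) * qt_eps \<mu> \<nu> \<gamma>)"

text \<open>
  A triple \<open>(p, v, d)\<close> stands for \<open>p + v + d\<close> with \<open>p\<close> in the loop algebra, \<open>v\<close> in \<open>V\<close>
  and \<open>d\<close> in the dual of \<open>V\<close>.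
\<close>

type_synonym ('l, 'g, 'v) affinization = "('l \<Rightarrow>\<^sub>0 'g) \<times> 'v \<times> ('v \<Rightarrow> complex)"

definition hat_scale ::
  "(complex \<Rightarrow> 'g::ab_group_add \<Rightarrow> 'g) \<Rightarrow> (complex \<Rightarrow> 'v::ab_group_add \<Rightarrow> 'v) \<Rightarrow> complex
    \<Rightarrow> ('l, 'g, 'v) affinization \<Rightarrow> ('l, 'g, 'v) affinization"
  where "hat_scale scale scaleV c = (\<lambda>(p, v, d).
    (\<Sum>\<nu>\<in>Poly_Mapping.keys p. Poly_Mapping.single \<nu> (scale c (Poly_Mapping.lookup p \<nu>)),
     scaleV c v,
     \<lambda>w. c * d w))"

definition degree_derivation ::
  "(complex \<Rightarrow> 'g::ab_group_add \<Rightarrow> 'g) \<Rightarrow> ('l \<Rightarrow> 'v) \<Rightarrow> ('v \<Rightarrow> complex) \<Rightarrow> ('l \<Rightarrow>\<^sub>0 'g) \<Rightarrow> 'l \<Rightarrow>\<^sub>0 'g"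
  where "degree_derivation scale \<iota> d p = (\<Sum>\<nu>\<in>Poly_Mapping.keys p.
    Poly_Mapping.single \<nu> (scale (d (\<iota> \<nu>)) (Poly_Mapping.lookup p \<nu>)))"

definition hat_bracket ::
  "(complex \<Rightarrow> 'g::ab_group_add \<Rightarrow> 'g) \<Rightarrow> ('g \<Rightarrow> 'g \<Rightarrow> 'g) \<Rightarrow> ('g \<Rightarrow> 'g \<Rightarrow> complex)
    \<Rightarrow> ('l::ab_group_add \<Rightarrow> 'l \<Rightarrow> complex) \<Rightarrow> (complex \<Rightarrow> 'v::ab_group_add \<Rightarrow> 'v) \<Rightarrow> ('l \<Rightarrow> 'v)
    \<Rightarrow> ('l, 'g, 'v) affinization \<Rightarrow> ('l, 'g, 'v) affinization \<Rightarrow> ('l, 'g, 'v) affinization"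
  where "hat_bracket scale br form \<mu> scaleV \<iota> = (\<lambda>(p, v, d) (q, w, e).
    (loop_bracket scale br \<mu> p q + degree_derivation scale \<iota> d q - degree_derivation scale \<iota> e p,
     \<Sum>\<nu>\<in>Poly_Mapping.keys p.
       scaleV (loop_form form \<mu> (Poly_Mapping.single \<nu> (Poly_Mapping.lookup p \<nu>)) q) (\<iota> \<nu>),
     0))"

definition hat_L ::
  "(complex \<Rightarrow> 'v::ab_group_add \<Rightarrow> 'v) \<Rightarrow> 'g::ab_group_add set \<Rightarrow> ('l, 'g, 'v) affinization set"
  where "hat_L scaleV g =
    {(p, v, d). (\<forall>\<nu>. Poly_Mapping.lookup p \<nu> \<in> g) \<and> d \<in> dual scaleV UNIV}"

definition hat_L_rho ::
  "(complex \<Rightarrow> 'g::ab_group_add \<Rightarrow> 'g) \<Rightarrow> (complex \<Rightarrow> 'v::ab_group_add \<Rightarrow> 'v) \<Rightarrow> 'g set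
    \<Rightarrow> ('g \<Rightarrow> 'g) \<Rightarrow> nat \<Rightarrow> ('l \<Rightarrow> int) \<Rightarrow> ('l, 'g, 'v) affinization set"
  where "hat_L_rho scale scaleV g \<sigma> m \<rho> =
    {(p, v, d). (\<forall>\<nu>. Poly_Mapping.lookup p \<nu> \<in> eigenspace scale g \<sigma> m (\<rho> \<nu>)) \<and>
      d \<in> dual scaleV UNIV}"

text \<open>The unit of the quantum torus is \<open>a\<^sup>0\<close>.\<close>

definition hat_h ::
  "(complex \<Rightarrow> 'v::ab_group_add \<Rightarrow> 'v) \<Rightarrow> 'g::ab_group_add set \<Rightarrow> ('g \<Rightarrow> 'g)
    \<Rightarrow> ('l::ab_group_add, 'g, 'v) affinization set"
  where "hat_h scaleV h \<sigma> =
    {(Poly_Mapping.single 0 k, v, d) |k v d. k \<in> fixed_points h \<sigma> \<and> d \<in> dual scaleV UNIV}"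

definition bar_tau ::
  "('g \<Rightarrow> 'g) \<Rightarrow> ('g \<Rightarrow> 'g) \<Rightarrow> ('l::ab_group_add, 'g::ab_group_add, 'v::ab_group_add) affinization
    \<Rightarrow> ('l, 'g, 'v) affinization"
  where "bar_tau \<tau> \<psi> = (\<lambda>(p, v, d).
    (\<Sum>\<nu>\<in>Poly_Mapping.keys p. Poly_Mapping.single (- \<nu>) (\<psi> (\<tau> (Poly_Mapping.lookup p \<nu>))),
     - v, - d))"


subsection \<open>The affinization on homogeneous elements\<close>

lemma lookup_tensor:
  assumes "vector_space scale"
  shows "Poly_Mapping.lookup (tensor scale x a) \<nu> = scale (Poly_Mapping.lookup a \<nu>) x"
proof -
  interpret vector_space scale by fact
  have "Poly_Mapping.lookup (tensor scale x a) \<nu> =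
    (\<Sum>k\<in>Poly_Mapping.keys a. if k = \<nu> then scale (Poly_Mapping.lookup a k) x else 0)"
    unfolding tensor_def lookup_sum by (intro sum.cong) (auto simp: lookup_single)
  also have "\<dots> = scale (Poly_Mapping.lookup a \<nu>) x"
    by (simp add: sum.delta in_keys_iff)
  finally show ?thesis .
qed

lemma keys_tensor:
  assumes "vector_space scale"
  shows "Poly_Mapping.keys (tensor scale x a) \<subseteq> Poly_Mapping.keys a"
proof -
  interpret vector_space scale by fact
  show ?thesis by (auto simp: in_keys_iff lookup_tensor[OF assms])
qed

lemma (in lie_algebra) loop_bracket_tensor:
  assumes x: "x \<in> L" and y: "y \<in> L"
  shows "loop_bracket scale br \<mu> (tensor scale x a) (tensor scale y b) =
    tensor scale (br x y) (qt_mult \<mu> a b)"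
proof (rule poly_mapping_eqI)
  fix k
  have vs: "vector_space scale" by unfold_locales
  note lt = lookup_tensor[OF vs]
  have sL: "scale c z \<in> L" if "z \<in> L" for c z
    using subspace_carrier that by (rule subspace_scale)
  have br0: "br 0 z = 0" "br z 0 = 0" if "z \<in> L" for z
    using br_scale_left[of z z 0] br_scale_right[of z z 0] that by auto
  have "loop_bracket scale br \<mu> (tensor scale x a) (tensor scale y b) =
    (\<Sum>\<nu>\<in>Poly_Mapping.keys a. \<Sum>\<gamma>\<in>Poly_Mapping.keys b. Poly_Mapping.single (\<nu> + \<gamma>)
      (scale (\<mu> \<nu> \<gamma>) (br (scale (Poly_Mapping.lookup a \<nu>) x) (scale (Poly_Mapping.lookup b \<gamma>) y))))"
    unfolding loop_bracket_def
  proof (rule sum.mono_neutral_cong_left, goal_cases)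
    case 3
    show ?case
    proof (intro ballI sum.neutral)
      fix i j assume "i \<in> Poly_Mapping.keys a - Poly_Mapping.keys (tensor scale x a)"
      then have "scale (Poly_Mapping.lookup a i) x = 0" by (auto simp: in_keys_iff lt)
      then show "Poly_Mapping.single (i + j) (scale (\<mu> i j) (br (scale (Poly_Mapping.lookup a i) x)
          (scale (Poly_Mapping.lookup b j) y))) = 0"
        by (simp only: br0(1)[OF sL[OF y]]) simp
    qed
  next
    case (4 i)
    show ?case
    proof (rule sum.mono_neutral_cong_left, goal_cases)
      case 3
      show ?case
      proof
        fix j assume "j \<in> Poly_Mapping.keys b - Poly_Mapping.keys (tensor scale y b)"
        then have "scale (Poly_Mapping.lookup b j) y = 0" by (auto simp: in_keys_iff lt)
        then show "Poly_Mapping.single (i + j) (scale (\<mu> i j) (br (scale (Poly_Mapping.lookup a i) x)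
            (scale (Poly_Mapping.lookup b j) y))) = 0"
          by (simp only: br0(2)[OF sL[OF x]]) simp
      qed
    qed (use keys_tensor[OF vs, of y b] in \<open>auto simp: lt\<close>)
  qed (use keys_tensor[OF vs, of x a] in auto)
  also have "\<dots> = (\<Sum>\<nu>\<in>Poly_Mapping.keys a. \<Sum>\<gamma>\<in>Poly_Mapping.keys b. Poly_Mapping.single (\<nu> + \<gamma>)
      (scale (\<mu> \<nu> \<gamma> * (Poly_Mapping.lookup a \<nu> * Poly_Mapping.lookup b \<gamma>)) (br x y)))"
    using x y by (simp add: br_scale_left br_scale_right sL mult_ac)
  finally have eq: "loop_bracket scale br \<mu> (tensor scale x a) (tensor scale y b) = \<dots>" .
  show "Poly_Mapping.lookup (loop_bracket scale br \<mu> (tensor scale x a) (tensor scale y b)) k =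
    Poly_Mapping.lookup (tensor scale (br x y) (qt_mult \<mu> a b)) k"
    unfolding eq lt qt_mult_def lookup_sum scale_sum_left
    by (intro sum.cong refl) (auto simp: lookup_single when_def)
qed

lemma (in eala) loop_form_tensor:
  assumes x: "x \<in> g" and y: "y \<in> g"
  shows "loop_form form \<mu> (tensor scale x a) (tensor scale y b) = form x y * qt_form \<mu> a b"
proof -
  have vs: "vector_space scale" by unfold_locales
  note lt = lookup_tensor[OF vs]
  have sL: "scale c z \<in> g" if "z \<in> g" for c z
    using subspace_carrier that by (rule subspace_scale)
  have form_scale': "form u (scale c w) = c * form u w" if "u \<in> g" "w \<in> g" for c u w
    using that form_scale[of w u c] form_sym[of u w] form_sym[of u "scale c w"] sL by metis
  have form0: "form 0 z = 0" "form z 0 = 0" if "z \<in> g" for z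
    using form_scale[of z z 0] form_scale'[of z z 0] that by auto
  have "loop_form form \<mu> (tensor scale x a) (tensor scale y b) =
    (\<Sum>\<nu>\<in>Poly_Mapping.keys a. \<Sum>\<gamma>\<in>Poly_Mapping.keys b.
      form (scale (Poly_Mapping.lookup a \<nu>) x) (scale (Poly_Mapping.lookup b \<gamma>) y) * qt_eps \<mu> \<nu> \<gamma>)"
    unfolding loop_form_def
  proof (rule sum.mono_neutral_cong_left, goal_cases)
    case 3
    show ?case
    proof (intro ballI sum.neutral)
      fix i j assume "i \<in> Poly_Mapping.keys a - Poly_Mapping.keys (tensor scale x a)"
      then have "scale (Poly_Mapping.lookup a i) x = 0" by (auto simp: in_keys_iff lt)
      then show "form (scale (Poly_Mapping.lookup a i) x) (scale (Poly_Mapping.lookup b j) y)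
          * qt_eps \<mu> i j = 0"
        by (simp only: form0(1)[OF sL[OF y]]) simp
    qed
  next
    case (4 i)
    show ?case
    proof (rule sum.mono_neutral_cong_left, goal_cases)
      case 3
      show ?case
      proof
        fix j assume "j \<in> Poly_Mapping.keys b - Poly_Mapping.keys (tensor scale y b)"
        then have "scale (Poly_Mapping.lookup b j) y = 0" by (auto simp: in_keys_iff lt)
        then show "form (scale (Poly_Mapping.lookup a i) x) (scale (Poly_Mapping.lookup b j) y)
            * qt_eps \<mu> i j = 0"
          by (simp only: form0(2)[OF sL[OF x]]) simp
      qed
    qed (use keys_tensor[OF vs, of y b] in \<open>auto simp: lt\<close>)
  qed (use keys_tensor[OF vs, of x a] in auto)
  also have "\<dots> = form x y * qt_form \<mu> a b"
    using x y by (simp add: form_scale form_scale' sL qt_form_def sum_distrib_left mult_ac)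
  finally show ?thesis .
qed

lemma (in eala) hat_bracket_homogeneous:
  assumes x: "x \<in> g" and y: "y \<in> g" and V: "vector_space scaleV"
  shows "hat_bracket scale br form \<mu> scaleV \<iota>
      (Poly_Mapping.single \<nu> x, v, d) (Poly_Mapping.single \<gamma> y, w, e) =
    (Poly_Mapping.single (\<nu> + \<gamma>) (scale (\<mu> \<nu> \<gamma>) (br x y))
       + Poly_Mapping.single \<gamma> (scale (d (\<iota> \<gamma>)) y) - Poly_Mapping.single \<nu> (scale (e (\<iota> \<nu>)) x),
     scaleV (form x y * qt_eps \<mu> \<nu> \<gamma>) (\<iota> \<nu>), 0)"
proof -
  interpret V: vector_space scaleV by fact
  have z: "br 0 y = 0" "br x 0 = 0"
    using br_scale_left[of y y 0] br_scale_right[of x x 0] x y by auto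
  have f: "form 0 y = 0" "form x 0 = 0"
    using form_scale[of y y 0] form_scale[of x x 0] form_sym[of x 0] subspace_0[OF subspace_carrier] x y
    by auto
  show ?thesis
    using z f by (simp add: hat_bracket_def loop_bracket_def degree_derivation_def loop_form_def)
qed

end

theory Submission
  imports Defs
begin

text \<open>
  The only structural point is that a Chevalley automorphism \<open>\<tau>\<close> preserves the form. If \<open>x\<close> and \<open>y\<close>
  have opposite weights \<open>\<alpha>\<close> and \<open>- \<alpha>\<close> then \<open>[x, y]\<close> lies in \<open>h\<close>, where \<open>\<tau>\<close> is \<open>- 1\<close>; comparing
  \<open>([x, y], k) = \<alpha>(k) (x, y)\<close> with the same identity for \<open>\<tau> x\<close> and \<open>\<tau> y\<close>, whose weights are
  \<open>- \<alpha>\<close> and \<open>\<alpha>\<close>, gives \<open>\<alpha>(k) (\<tau> x, \<tau> y) = \<alpha>(k) (x, y)\<close>. Hence \<open>\<psi> \<tau>\<close> preserves the bracket and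
  the form, and \<open>\<mu>(\<lambda>, \<gamma>) = \<mu>(- \<lambda>, - \<gamma>)\<close> makes the assignment an automorphism. Its powers act on the
  component of degree \<open>\<lambda>\<close> through powers of \<open>\<psi> \<tau>\<close>, and \<open>g\<close> is the sum of the eigenspaces of
  \<open>\<sigma>\<close>, all of which occur because \<open>\<rho>\<close> is onto; so the two maps have finite order simultaneously.
\<close>


section \<open>Lie algebra automorphisms\<close>

context lie_algebra
begin

lemma closed_scale: "x \<in> L \<Longrightarrow> scale c x \<in> L"
  by (rule subspace_scale[OF subspace_carrier])

lemma closed_0: "0 \<in> L"
  by (rule subspace_0[OF subspace_carrier])

lemma closed_add: "x \<in> L \<Longrightarrow> y \<in> L \<Longrightarrow> x + y \<in> L"
  by (rule subspace_add[OF subspace_carrier])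

lemma closed_minus: "x \<in> L \<Longrightarrow> - x \<in> L"
  by (rule subspace_neg[OF subspace_carrier])

lemma closed_sum: "(\<And>i. i \<in> I \<Longrightarrow> f i \<in> L) \<Longrightarrow> sum f I \<in> L"
  by (rule subspace_sum[OF subspace_carrier])

lemma br_minus:
  assumes "x \<in> L" "y \<in> L"
  shows "br (- x) y = - br x y" "br x (- y) = - br x y"
  using br_scale_left[of x y "- 1"] br_scale_right[of x y "- 1"] assms by auto

lemma br_skew:
  assumes "x \<in> L" "y \<in> L"
  shows "br y x = - br x y"
proof -
  have "br (x + y) (x + y) = br x y + br y x"
    using assms by (simp add: br_add_left br_add_right closed_add br_self[of x] br_self[of y])
  then have "br x y + br y x = 0"
    using br_self[OF closed_add[OF assms]] by simp
  then show ?thesis by (simp add: eq_neg_iff_add_eq_0 add.commute)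
qed

end

text \<open>Locale version of the predicate, so that the same facts can be instantiated for
  \<open>\<sigma>\<close>, \<open>\<tau>\<close>, \<open>\<psi>\<close>, the composite of
  \<open>\<psi>\<close> and \<open>\<tau>\<close>, and powers.\<close>

locale lie_algebra_automorphism = lie_algebra scale L br
  for scale :: "complex \<Rightarrow> 'a::ab_group_add \<Rightarrow> 'a" and L br +
  fixes \<phi> :: "'a \<Rightarrow> 'a"
  assumes aut: "lie_automorphism scale L br \<phi>"
begin

lemma bij: "bij_betw \<phi> L L"
  and add: "x \<in> L \<Longrightarrow> y \<in> L \<Longrightarrow> \<phi> (x + y) = \<phi> x + \<phi> y"
  and scaled: "x \<in> L \<Longrightarrow> \<phi> (scale c x) = scale c (\<phi> x)"
  and bracket: "x \<in> L \<Longrightarrow> y \<in> L \<Longrightarrow> \<phi> (br x y) = br (\<phi> x) (\<phi> y)"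
  using aut by (auto simp: lie_automorphism_def)

lemma closed: "x \<in> L \<Longrightarrow> \<phi> x \<in> L"
  using bij by (rule bij_betwE[rule_format])

lemma zero: "\<phi> 0 = 0"
  using scaled[OF closed_0, of 0] by simp

lemma minus: "x \<in> L \<Longrightarrow> \<phi> (- x) = - \<phi> x"
  using scaled[of x "- 1"] by simp

lemma diff: "x \<in> L \<Longrightarrow> y \<in> L \<Longrightarrow> \<phi> (x - y) = \<phi> x - \<phi> y"
  using add[of x "- y"] minus[of y] closed_minus by simp

lemma eq_0_iff: "x \<in> L \<Longrightarrow> \<phi> x = 0 \<longleftrightarrow> x = 0"
  using bij closed_0 zero by (metis bij_betw_inv_into_left)

lemma sum: "(\<And>i. i \<in> I \<Longrightarrow> f i \<in> L) \<Longrightarrow> \<phi> (sum f I) = (\<Sum>i\<in>I. \<phi> (f i))"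
  by (induction I rule: infinite_finite_induct) (simp_all add: zero add closed_sum)

text \<open>Makes additivity and injectivity available for a power of \<open>\<phi>\<close>, as the
  finite order argument requires.\<close>

lemma funpow: "lie_algebra_automorphism scale L br (\<phi> ^^ n)"
proof unfold_locales
  have c: "(\<phi> ^^ n) x \<in> L" if "x \<in> L" for x n
    using that by (induction n) (auto simp: closed)
  have "bij_betw (\<phi> ^^ n) L L"
    using bij by (rule bij_betw_funpow)
  moreover have "(\<phi> ^^ n) (x + y) = (\<phi> ^^ n) x + (\<phi> ^^ n) y"
    "(\<phi> ^^ n) (br x y) = br ((\<phi> ^^ n) x) ((\<phi> ^^ n) y)"
    "(\<phi> ^^ n) (scale r x) = scale r ((\<phi> ^^ n) x)"
    if "x \<in> L" "y \<in> L" for x y r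
    using that c by (induction n) (auto simp: add bracket scaled)
  ultimately show "lie_automorphism scale L br (\<phi> ^^ n)"
    by (auto simp: lie_automorphism_def)
qed

end

lemma (in lie_algebra) lie_automorphism_comp:
  assumes "lie_automorphism scale L br f" "lie_automorphism scale L br f'"
  shows "lie_automorphism scale L br (f \<circ> f')"
proof -
  have "bij_betw (f \<circ> f') L L"
    using assms by (intro bij_betw_trans[where B = L and C = L]) (simp_all add: lie_automorphism_def)
  moreover have "f' x \<in> L" if "x \<in> L" for x
    using assms(2) that by (auto simp: lie_automorphism_def bij_betw_def)
  ultimately show ?thesis
    using assms by (auto simp: lie_automorphism_def)
qed


section \<open>Chevalley automorphisms preserve the form\<close>

context eala
begin

section \<open>Bilinearity and weight spaces\<close>

lemma form_add_right:
  "x \<in> g \<Longrightarrow> y \<in> g \<Longrightarrow> z \<in> g \<Longrightarrow> form x (y + z) = form x y + form x z"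
  by (metis closed_add form_add form_sym)

lemma form_scale_right: "x \<in> g \<Longrightarrow> y \<in> g \<Longrightarrow> form x (scale c y) = c * form x y"
  by (metis closed_scale form_scale form_sym)

lemma form_zero:
  assumes "x \<in> g"
  shows "form 0 x = 0" "form x 0 = 0"
  using form_scale[of x x 0] form_scale_right[of x x 0] assms by auto

lemma form_minus:
  assumes "x \<in> g" "y \<in> g"
  shows "form (- x) y = - form x y" "form x (- y) = - form x y"
  using form_scale[of x y "- 1"] form_scale_right[of x y "- 1"] assms by auto

lemma root_spaceD:
  assumes "x \<in> root_space scale g br h \<alpha>"
  shows "x \<in> g" "k \<in> h \<Longrightarrow> br k x = scale (\<alpha> k) x"
  using assms by (auto simp: root_space_def)

text \<open>Invariance evaluates ([x, y], k) in two ways: by moving the bracket onto y and k, or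
  onto k and x. Comparing the two results yields orthogonality of weight spaces whose weights do not
  cancel.\<close>

lemma form_bracket_root_space:
  assumes x: "x \<in> root_space scale g br h \<alpha>" and y: "y \<in> root_space scale g br h \<beta>" and k: "k \<in> h"
  shows "form (br x y) k = - \<beta> k * form x y" "form (br x y) k = \<alpha> k * form x y"
proof -
  note xg = root_spaceD(1)[OF x] and yg = root_spaceD(1)[OF y]
  have kg: "k \<in> g" using k h_subset by auto
  have "br y k = scale (- \<beta> k) y"
    using br_skew[OF kg yg] root_spaceD(2)[OF y k] by simp
  then show "form (br x y) k = - \<beta> k * form x y"
    using A1_invariant[OF xg yg kg] form_scale_right[OF xg yg, of "- \<beta> k"] by simp
  have "form (br x y) k = form (br k x) y"
    using A1_invariant[OF kg xg yg] form_sym[OF kg br_closed[OF xg yg]] by simp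
  then show "form (br x y) k = \<alpha> k * form x y"
    using root_spaceD(2)[OF x k] form_scale[OF xg yg] by simp
qed

lemma form_root_spaces_orthogonal:
  assumes "x \<in> root_space scale g br h \<alpha>" "y \<in> root_space scale g br h \<beta>"
    and "k \<in> h" "\<alpha> k + \<beta> k \<noteq> 0"
  shows "form x y = 0"
proof -
  have "(\<alpha> k + \<beta> k) * form x y = 0"
    using form_bracket_root_space[OF assms(1-3)] by (simp add: algebra_simps)
  then show ?thesis using assms(4) by simp
qed

text \<open>By the Jacobi identity [x, y] has weight \<open>\<alpha> + \<beta>\<close>, which
  vanishes on \<open>h\<close>, and by \<open>A2_zero\<close> the zero weight space is
  \<open>h\<close>. Weights are compared only on \<open>h\<close>, the only place where
  \<open>root_space\<close> looks at them.\<close>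

lemma bracket_opposite_root_spaces:
  assumes x: "x \<in> root_space scale g br h \<alpha>" and y: "y \<in> root_space scale g br h \<beta>"
    and opp: "\<And>k. k \<in> h \<Longrightarrow> \<alpha> k + \<beta> k = 0"
  shows "br x y \<in> h"
proof -
  note xg = root_spaceD(1)[OF x] and yg = root_spaceD(1)[OF y]
  have "br k (br x y) = 0" if k: "k \<in> h" for k
  proof -
    have kg: "k \<in> g" using k h_subset by auto
    have "br x (br y k) = scale (- \<beta> k) (br x y)"
      using br_skew[OF kg yg] root_spaceD(2)[OF y k] br_scale_right[OF xg yg, of "- \<beta> k"] by simp
    moreover have "br y (br k x) = scale (- \<alpha> k) (br x y)"
      using root_spaceD(2)[OF x k] br_scale_right[OF yg xg, of "\<alpha> k"] br_skew[OF xg yg] by simp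
    ultimately have "br k (br x y) = scale (\<alpha> k + \<beta> k) (br x y)"
      using jacobi[OF kg xg yg] by (simp add: scale_left_distrib algebra_simps add_eq_0_iff)
    with opp[OF k] show ?thesis by simp
  qed
  then have "br x y \<in> root_space scale g br h 0"
    using br_closed[OF xg yg] by (simp add: root_space_def)
  then show ?thesis by (simp add: A2_zero)
qed

text \<open>Weight vectors span \<open>g\<close>, so bilinearity reduces the claim to them. The
  first argument is extended while the second is a weight vector, then the second.\<close>

lemma automorphism_form_eqI:
  assumes \<phi>: "lie_automorphism scale g br \<phi>"
    and eq: "\<And>\<alpha> \<beta> x y. \<alpha> \<in> dual scale h \<Longrightarrow> \<beta> \<in> dual scale h \<Longrightarrow>
      x \<in> root_space scale g br h \<alpha> \<Longrightarrow> y \<in> root_space scale g br h \<beta> \<Longrightarrow>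
      form (\<phi> x) (\<phi> y) = form x y"
    and x: "x \<in> g" and y: "y \<in> g"
  shows "form (\<phi> x) (\<phi> y) = form x y"
proof -
  interpret \<phi>: lie_algebra_automorphism scale g br \<phi> by unfold_locales (fact \<phi>)
  let ?G = "\<Union>\<alpha>\<in>dual scale h. root_space scale g br h \<alpha>"
  have G: "?G \<subseteq> g" by (auto simp: root_space_def)
  have 1: "form (\<phi> x) (\<phi> z) = form x z" if z: "z \<in> ?G" for z
  proof -
    have zg: "z \<in> g" using z G by auto
    have "x \<in> span ?G" using x by (simp add: A2_decomposition)
    \<comment> \<open>Membership in \<open>g\<close> is carried through the induction because
      \<open>\<phi>\<close> and \<open>form\<close> are known to be linear only there.\<close>
    then have "x \<in> g \<and> form (\<phi> x) (\<phi> z) = form x z"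
    proof (induction rule: span_induct_alt)
      case base
      then show ?case using closed_0 zg by (simp add: \<phi>.zero form_zero \<phi>.closed)
    next
      case (step c u v)
      have u: "u \<in> g" "form (\<phi> u) (\<phi> z) = form u z"
        using step(1) z eq by (auto simp: root_space_def)
      then show ?case
        using step(2) zg
        by (simp add: \<phi>.add \<phi>.scaled \<phi>.closed closed_add closed_scale form_add form_scale)
    qed
    then show ?thesis by simp
  qed
  have "y \<in> span ?G" using y by (simp add: A2_decomposition)
  then have "y \<in> g \<and> form (\<phi> x) (\<phi> y) = form x y"
  proof (induction rule: span_induct_alt)
    case base
    then show ?case using closed_0 x by (simp add: \<phi>.zero form_zero \<phi>.closed)
  next
    case (step c u v)
    have "u \<in> g" "form (\<phi> x) (\<phi> u) = form x u" using step(1) G 1 by auto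
    then show ?case
      using step(2) x
      by (simp add: \<phi>.add \<phi>.scaled \<phi>.closed closed_add closed_scale form_add_right form_scale_right)
  qed
  then show ?thesis by simp
qed

text \<open>Form preservation is part of the definition of a pair for \<open>\<psi>\<close> only;
  for \<open>\<tau>\<close> it follows from \<open>\<tau>\<close> being minus the identity on
  \<open>h\<close>.\<close>

lemma chevalley_automorphism_form:
  assumes "chevalley_automorphism scale g br h \<tau>" and "x \<in> g" "y \<in> g"
  shows "form (\<tau> x) (\<tau> y) = form x y"
proof (rule automorphism_form_eqI[OF _ _ assms(2,3)])
  show aut: "lie_automorphism scale g br \<tau>"
    using assms(1) by (simp add: chevalley_automorphism_def)
  have on_h: "\<tau> k = - k" if "k \<in> h" for k
    using assms(1) that by (simp add: chevalley_automorphism_def)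
  interpret \<tau>: lie_algebra_automorphism scale g br \<tau> by unfold_locales (fact aut)
  have root: "\<tau> x \<in> root_space scale g br h (\<lambda>k. - \<alpha> k)" if x: "x \<in> root_space scale g br h \<alpha>" for \<alpha> x
  proof -
    note xg = root_spaceD(1)[OF x]
    have "br k (\<tau> x) = scale (- \<alpha> k) (\<tau> x)" if k: "k \<in> h" for k
    proof -
      have kg: "k \<in> g" using k h_subset by auto
      \<comment> \<open>Since \<open>\<tau>\<close> negates \<open>h\<close>, the element k is
        itself the image of - k; hence \<open>\<tau>\<close> reverses weights.\<close>
      have "br k (\<tau> x) = br (\<tau> (- k)) (\<tau> x)"
        using on_h[OF k] \<tau>.minus[OF kg] by simp
      also have "\<dots> = \<tau> (scale (- \<alpha> k) x)"
        using \<tau>.bracket[OF closed_minus[OF kg] xg] br_minus(1)[OF kg xg] root_spaceD(2)[OF x k] by simp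
      also have "\<dots> = scale (- \<alpha> k) (\<tau> x)" by (rule \<tau>.scaled[OF xg])
      finally show ?thesis .
    qed
    then show ?thesis using \<tau>.closed[OF xg] by (simp add: root_space_def)
  qed
  fix \<alpha> \<beta> x y
  assume x: "x \<in> root_space scale g br h \<alpha>" and y: "y \<in> root_space scale g br h \<beta>"
  note xg = root_spaceD(1)[OF x] and yg = root_spaceD(1)[OF y]
  \<comment> \<open>If the weights do not cancel, both sides vanish. If they cancel and
    \<open>\<alpha>\<close> is non-zero at some k, the factor \<open>\<alpha> k\<close> can be
    divided out. If both are zero on \<open>h\<close>, then x and y lie in \<open>h\<close> and two
    signs cancel.\<close>
  consider (orth) k where "k \<in> h" "\<alpha> k + \<beta> k \<noteq> 0"
    | (opp) k where "k \<in> h" "\<alpha> k \<noteq> 0" "\<And>k. k \<in> h \<Longrightarrow> \<alpha> k + \<beta> k = 0"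
    | (zero) "\<And>k. k \<in> h \<Longrightarrow> \<alpha> k = 0" "\<And>k. k \<in> h \<Longrightarrow> \<beta> k = 0"
    by (metis add_0)
  then show "form (\<tau> x) (\<tau> y) = form x y"
  proof cases
    case orth
    have "- \<alpha> k + - \<beta> k \<noteq> 0"
      using orth(2) by (metis add.inverse_distrib_swap add.commute neg_equal_0_iff_equal)
    then show ?thesis
      using form_root_spaces_orthogonal[OF x y orth] form_root_spaces_orthogonal[OF root[OF x] root[OF y] orth(1)]
      by simp
  next
    case opp
    have xy: "br x y \<in> h" by (rule bracket_opposite_root_spaces[OF x y opp(3)])
    have "- \<alpha> k * form (\<tau> x) (\<tau> y) = form (br (\<tau> x) (\<tau> y)) k"
      using form_bracket_root_space(2)[OF root[OF x] root[OF y] opp(1)] by simp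
    also have "\<dots> = - form (br x y) k"
      using on_h[OF xy] \<tau>.bracket[OF xg yg] form_minus(1)[of "br x y" k] br_closed[OF xg yg] opp(1) h_subset
      by auto
    also have "\<dots> = - \<alpha> k * form x y"
      using form_bracket_root_space(2)[OF x y opp(1)] by simp
    finally show ?thesis using opp(2) by simp
  next
    case zero
    have "x \<in> root_space scale g br h 0" "y \<in> root_space scale g br h 0"
      using x y zero by (auto simp: root_space_def)
    then have "x \<in> h" "y \<in> h" by (simp_all add: A2_zero)
    then show ?thesis
      using on_h form_minus xg yg closed_minus by simp
  qed
qed

end


section \<open>Eigenspaces of a finite order automorphism\<close>

lemma root_of_unity_powi_cong:
  assumes "0 < m" "i mod int m = j mod int m"
  shows "exp (2 * of_real pi * \<i> / of_nat m) powi i = (exp (2 * of_real pi * \<i> / of_nat m) powi j :: complex)"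
proof -
  let ?w = "exp (2 * of_real pi * \<i> / of_nat m) :: complex"
  have wm: "?w ^ m = 1"
    using assms(1) by (simp add: exp_of_nat_mult[symmetric])
  have red: "?w powi i = ?w powi (i mod int m)" for i
  proof -
    have "?w powi i = ?w powi (int m * (i div int m)) * ?w powi (i mod int m)"
      by (subst power_int_add[symmetric]) simp_all
    also have "\<dots> = (?w powi int m) powi (i div int m) * ?w powi (i mod int m)"
      by (simp only: power_int_mult)
    finally show ?thesis using wm by simp
  qed
  show ?thesis using red[of i] red[of j] assms(2) by simp
qed

lemma eigenspace_cong:
  assumes "0 < m" "i mod int m = j mod int m"
  shows "eigenspace scale g \<sigma> m i = eigenspace scale g \<sigma> m j"
  using root_of_unity_powi_cong[OF assms] by (simp add: eigenspace_def)

text \<open>Orthogonality of the characters of the cyclic group: for 0 < i < m the summands are the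
  powers of some z with z distinct from 1 and z ^ m = 1, so the geometric sum vanishes.\<close>

lemma sum_roots_of_unity:
  assumes "i < m"
  shows "(\<Sum>j<m. exp (2 * of_real pi * \<i> / of_nat m) powi (- int i * int j)) =
    (if i = 0 then of_nat m else (0 :: complex))"
proof (cases "i = 0")
  case False
  have m: "m \<noteq> 0" using assms by simp
  let ?w = "exp (2 * of_real pi * \<i> / of_nat m) :: complex"
  let ?z = "?w powi (- int i)"
  have wm: "?w ^ m = 1"
    using m by (simp add: exp_of_nat_mult[symmetric])
  have "?w ^ i \<noteq> 1"
  proof
    assume "?w ^ i = 1"
    moreover have "?w ^ i = cis (2 * pi * real i / real m)"
      using Complex.DeMoivre[of "2 * pi / real m" i] by (simp add: cis_conv_exp field_simps)
    ultimately have "cis (2 * pi * real i / real m) = cis (2 * pi * real 0 / real m)" by simp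
    \<comment> \<open>The m-th roots of unity are in bijection with the exponents below m, so i
      would equal 0.\<close>
    then show False
      using inj_onD[OF bij_betw_imp_inj_on[OF bij_betw_roots_unity[of m]], of i 0] assms False by simp
  qed
  then have z1: "?z \<noteq> 1" by (simp add: power_int_minus)
  have zm: "?z ^ m = 1"
    using wm by (simp add: power_int_minus power_inverse power_mult[symmetric] mult.commute)
      (metis power_mult power_one mult.commute inverse_1)
  have "(\<Sum>j<m. ?w powi (- int i * int j)) = (\<Sum>j<m. ?z ^ j)"
    by (intro sum.cong refl) (simp only: power_int_mult power_int_of_nat)
  also have "\<dots> = 0" using geometric_sum[OF z1, of m] zm by simp
  finally show ?thesis using False by simp
qed simp

context lie_algebra
begin

text \<open>The component \<open>y j\<close> is the discrete Fourier projection of x, an average of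
  the \<open>\<sigma> ^^ i\<close> applied to x. Applying \<open>\<sigma>\<close> shifts the index i
  at the cost of the eigenvalue, and summing over j leaves only the term i = 0.\<close>

lemma finite_order_eigenspace_decomposition:
  assumes aut: "lie_automorphism scale L br \<sigma>" and m: "0 < m"
    and order: "\<And>x. x \<in> L \<Longrightarrow> (\<sigma> ^^ m) x = x" and x: "x \<in> L"
  obtains y where "\<And>j. y j \<in> eigenspace scale L \<sigma> m (int j)" "x = (\<Sum>j<m. y j)"
proof -
  interpret \<sigma>: lie_algebra_automorphism scale L br \<sigma> by unfold_locales (fact aut)
  let ?w = "exp (2 * of_real pi * \<i> / of_nat m) :: complex"
  define a where "a j i = scale (?w powi (- int i * int j)) ((\<sigma> ^^ i) x)" for j i :: nat
  have c: "(\<sigma> ^^ i) x \<in> L" for i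
    using x by (induction i) (auto simp: \<sigma>.closed)
  have aL: "a j i \<in> L" for i j by (simp add: a_def closed_scale c)
  define y where "y j = scale (1 / of_nat m) (\<Sum>i<m. a j i)" for j
  have "y j \<in> eigenspace scale L \<sigma> m (int j)" for j
  proof -
    have wm: "?w powi (- int m * int j) = 1"
      using root_of_unity_powi_cong[OF m, of "- int m * int j" 0] by simp
    \<comment> \<open>The summands are periodic in i, so the shifted sum has the same value.\<close>
    have am: "a j m = a j 0"
      using wm order[OF x] by (simp add: a_def)
    have "\<sigma> (a j i) = scale (?w powi int j) (a j (Suc i))" for i
    proof -
      have "?w powi int j * ?w powi (- int (Suc i) * int j) = ?w powi (- int i * int j)"
        by (subst power_int_add[symmetric]) (auto simp: algebra_simps)
      then show ?thesis using \<sigma>.scaled[OF c] by (simp only: a_def scale_scale) simp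
    qed
    then have "\<sigma> (\<Sum>i<m. a j i) = scale (?w powi int j) (\<Sum>i<m. a j (Suc i))"
      using \<sigma>.sum[of "{..<m}" "a j"] aL by (simp add: scale_sum_right)
    also have "(\<Sum>i<m. a j (Suc i)) = (\<Sum>i<m. a j i)"
      using sum.lessThan_Suc_shift[of "a j" m] am by (simp add: add.commute)
    finally show ?thesis
      by (simp add: eigenspace_def y_def \<sigma>.scaled closed_scale closed_sum aL mult.commute)
  qed
  moreover have "x = (\<Sum>j<m. y j)"
  proof -
    have "(\<Sum>j<m. y j) = scale (1 / of_nat m) (\<Sum>i<m. \<Sum>j<m. a j i)"
      unfolding y_def by (subst sum.swap) (simp add: scale_sum_right)
    also have "(\<Sum>i<m. \<Sum>j<m. a j i) = (\<Sum>i<m. if i = 0 then scale (of_nat m) x else 0)"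
    proof (intro sum.cong refl)
      fix i assume "i \<in> {..<m}"
      then show "(\<Sum>j<m. a j i) = (if i = 0 then scale (of_nat m) x else 0)"
        using sum_roots_of_unity[of i m]
        by (simp only: a_def scale_sum_left[symmetric]) simp
    qed
    also have "\<dots> = scale (of_nat m) x" using m by simp
    finally show ?thesis using m by simp
  qed
  ultimately show ?thesis using that by blast
qed

end


section \<open>The twisted negation on the affinization\<close>

text \<open>The loop part of \<open>bar_tau\<close>, for an arbitrary map \<open>\<phi>\<close> in
  place of the composite of \<open>\<psi>\<close> and \<open>\<tau>\<close>.\<close>

definition neg_twist :: "('g \<Rightarrow> 'g) \<Rightarrow> ('l::ab_group_add \<Rightarrow>\<^sub>0 'g::ab_group_add) \<Rightarrow> 'l \<Rightarrow>\<^sub>0 'g"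
  where "neg_twist \<phi> p =
    (\<Sum>\<nu>\<in>Poly_Mapping.keys p. Poly_Mapping.single (- \<nu>) (\<phi> (Poly_Mapping.lookup p \<nu>)))"

lemma bar_tau_eq: "bar_tau \<tau> \<psi> = (\<lambda>(p, v, d). (neg_twist (\<psi> \<circ> \<tau>) p, - v, - d))"
  by (simp add: bar_tau_def neg_twist_def)

text \<open>The sum runs over the support only; the hypothesis makes the formula correct in the
  remaining degrees as well.\<close>

lemma lookup_sum_keys_single:
  assumes "f \<nu> 0 = 0"
  shows "Poly_Mapping.lookup (\<Sum>\<nu>\<in>Poly_Mapping.keys p.
    Poly_Mapping.single \<nu> (f \<nu> (Poly_Mapping.lookup p \<nu>))) \<nu> = f \<nu> (Poly_Mapping.lookup p \<nu>)"
  using assms by (auto simp: lookup_sum lookup_single when_def sum.delta in_keys_iff)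

lemma lookup_neg_twist:
  assumes "\<phi> 0 = 0"
  shows "Poly_Mapping.lookup (neg_twist \<phi> p) \<nu> = \<phi> (Poly_Mapping.lookup p (- \<nu>))"
proof -
  have "Poly_Mapping.lookup (neg_twist \<phi> p) \<nu> =
    (\<Sum>\<kappa>\<in>Poly_Mapping.keys p. if \<kappa> = - \<nu> then \<phi> (Poly_Mapping.lookup p \<kappa>) else 0)"
    unfolding neg_twist_def lookup_sum
    by (intro sum.cong) (auto simp: lookup_single when_def)
  then show ?thesis using assms by (simp add: sum.delta in_keys_iff)
qed

lemma neg_twist_single:
  "\<phi> 0 = 0 \<Longrightarrow> neg_twist \<phi> (Poly_Mapping.single \<nu> x) = Poly_Mapping.single (- \<nu>) (\<phi> x)"
  by (rule poly_mapping_eqI) (auto simp: lookup_neg_twist lookup_single when_def)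

lemma neg_twist_inverse:
  assumes "\<phi> 0 = 0" "\<phi>' 0 = 0" "\<And>\<nu>. \<phi>' (\<phi> (Poly_Mapping.lookup p \<nu>)) = Poly_Mapping.lookup p \<nu>"
  shows "neg_twist \<phi>' (neg_twist \<phi> p) = p"
  using assms by (intro poly_mapping_eqI) (simp add: lookup_neg_twist)

text \<open>Common form of \<open>hat_L\<close> (constant \<open>S\<close>) and
  \<open>hat_L_rho\<close> (eigenspaces), so that both automorphism claims have a single
  proof.\<close>

definition graded_affinization ::
  "(complex \<Rightarrow> 'v::ab_group_add \<Rightarrow> 'v) \<Rightarrow> ('l \<Rightarrow> 'g::ab_group_add set) \<Rightarrow> ('l, 'g, 'v) affinization set"
  where "graded_affinization scaleV S =
    {(p, v, d). (\<forall>\<nu>. Poly_Mapping.lookup p \<nu> \<in> S \<nu>) \<and> d \<in> dual scaleV UNIV}"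

lemma hat_L_eq: "hat_L scaleV g = graded_affinization scaleV (\<lambda>_. g)"
  by (simp add: hat_L_def graded_affinization_def)

lemma hat_L_rho_eq:
  "hat_L_rho scale scaleV g \<sigma> m \<rho> = graded_affinization scaleV (\<lambda>\<nu>. eigenspace scale g \<sigma> m (\<rho> \<nu>))"
  by (simp add: hat_L_rho_def graded_affinization_def)

lemma dual_UNIV_uminus: "d \<in> dual scaleV UNIV \<Longrightarrow> - d \<in> dual scaleV UNIV"
  by (auto simp: dual_def)

lemma dual_UNIV_neg:
  assumes "d \<in> dual scaleV UNIV"
  shows "d (- v) = - d v"
proof -
  have add: "d (x + y) = d x + d y" for x y
    using assms by (simp add: dual_def)
  have "d 0 = 0" using add[of 0 0] by simp
  then have "d (- v) + d v = 0" using add[of "- v" v] by simp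
  then show ?thesis by (simp add: eq_neg_iff_add_eq_0)
qed

locale eala_form_automorphism =
  eala scale g br form h + lie_algebra_automorphism scale g br \<phi>
  for scale :: "complex \<Rightarrow> 'g::ab_group_add \<Rightarrow> 'g" and g br form h \<phi> +
  assumes form_preserved: "x \<in> g \<Longrightarrow> y \<in> g \<Longrightarrow> form (\<phi> x) (\<phi> y) = form x y"
begin

section \<open>Compatibility of the twist with bracket, derivations and form\<close>

abbreviation loop_carrier :: "('l \<Rightarrow>\<^sub>0 'g) \<Rightarrow> bool"
  where "loop_carrier p \<equiv> \<forall>\<nu>. Poly_Mapping.lookup p \<nu> \<in> g"

lemma neg_twist_add:
  "loop_carrier p \<Longrightarrow> loop_carrier q \<Longrightarrow> neg_twist \<phi> (p + q) = neg_twist \<phi> p + neg_twist \<phi> q"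
  by (rule poly_mapping_eqI) (simp add: lookup_neg_twist zero lookup_add add)

lemma neg_twist_diff:
  "loop_carrier p \<Longrightarrow> loop_carrier q \<Longrightarrow> neg_twist \<phi> (p - q) = neg_twist \<phi> p - neg_twist \<phi> q"
  by (rule poly_mapping_eqI) (simp add: lookup_neg_twist zero lookup_minus diff)

lemma loop_carrier_sum: "(\<And>i. i \<in> I \<Longrightarrow> loop_carrier (f i)) \<Longrightarrow> loop_carrier (\<Sum>i\<in>I. f i)"
  by (simp add: lookup_sum closed_sum)

lemma loop_carrier_single: "x \<in> g \<Longrightarrow> loop_carrier (Poly_Mapping.single \<nu> x)"
  by (simp add: lookup_single when_def closed_0)

lemma neg_twist_sum:
  "(\<And>i. i \<in> I \<Longrightarrow> loop_carrier (f i)) \<Longrightarrow> neg_twist \<phi> (\<Sum>i\<in>I. f i) = (\<Sum>i\<in>I. neg_twist \<phi> (f i))"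
  by (rule poly_mapping_eqI) (simp add: lookup_neg_twist zero lookup_sum sum)

text \<open>By injectivity of \<open>\<phi>\<close> on \<open>g\<close> no component is lost, so the
  support is exactly reflected and sums over it can be reindexed.\<close>

lemma keys_neg_twist:
  "loop_carrier p \<Longrightarrow> Poly_Mapping.keys (neg_twist \<phi> p) = uminus ` Poly_Mapping.keys p"
  by (force simp: in_keys_iff lookup_neg_twist zero eq_0_iff image_iff)

lemma sum_keys_neg_twist:
  assumes "loop_carrier p"
  shows "(\<Sum>\<nu>\<in>Poly_Mapping.keys (neg_twist \<phi> p). f \<nu>) = (\<Sum>\<nu>\<in>Poly_Mapping.keys p. f (- \<nu>))"
  by (simp add: keys_neg_twist[OF assms] sum.reindex inj_on_def)

text \<open>Negation of degrees is additive, and the cocycle takes the same value on the negated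
  degrees.\<close>

lemma neg_twist_loop_bracket:
  assumes p: "loop_carrier p" and q: "loop_carrier q" and \<mu>: "\<And>\<nu> \<gamma>. \<mu> \<nu> \<gamma> = \<mu> (- \<nu>) (- \<gamma>)"
  shows "neg_twist \<phi> (loop_bracket scale br \<mu> p q) =
    loop_bracket scale br \<mu> (neg_twist \<phi> p) (neg_twist \<phi> q)"
proof -
  have "loop_bracket scale br \<mu> (neg_twist \<phi> p) (neg_twist \<phi> q) =
    (\<Sum>\<nu>\<in>Poly_Mapping.keys p. \<Sum>\<gamma>\<in>Poly_Mapping.keys q. neg_twist \<phi> (Poly_Mapping.single (\<nu> + \<gamma>)
      (scale (\<mu> \<nu> \<gamma>) (br (Poly_Mapping.lookup p \<nu>) (Poly_Mapping.lookup q \<gamma>)))))"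
    unfolding loop_bracket_def sum_keys_neg_twist[OF p] sum_keys_neg_twist[OF q]
    using p q
    by (simp add: lookup_neg_twist neg_twist_single zero scaled bracket br_closed \<mu>[symmetric])
  also have "\<dots> = neg_twist \<phi> (loop_bracket scale br \<mu> p q)"
    unfolding loop_bracket_def using p q
    by (subst neg_twist_sum, intro loop_carrier_sum loop_carrier_single closed_scale br_closed, simp_all)
       (subst neg_twist_sum, intro loop_carrier_single closed_scale br_closed, simp_all)
  finally show ?thesis by simp
qed

lemma lookup_degree_derivation:
  "Poly_Mapping.lookup (degree_derivation scale \<iota> d p) \<nu> = scale (d (\<iota> \<nu>)) (Poly_Mapping.lookup p \<nu>)"
  unfolding degree_derivation_def
  by (rule lookup_sum_keys_single[where f = "\<lambda>\<nu>. scale (d (\<iota> \<nu>))"]) simp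

text \<open>Two signs cancel: \<open>- d\<close> evaluated at the negated degree is \<open>d\<close>
  at the original one.\<close>

lemma neg_twist_degree_derivation:
  assumes "loop_carrier p" "d \<in> dual scaleV UNIV" "\<And>\<nu>. \<iota> (- \<nu>) = - \<iota> \<nu>"
  shows "neg_twist \<phi> (degree_derivation scale \<iota> d p) = degree_derivation scale \<iota> (- d) (neg_twist \<phi> p)"
  using assms
  by (intro poly_mapping_eqI)
    (simp add: lookup_neg_twist zero lookup_degree_derivation scaled minus closed_scale dual_UNIV_neg)

lemma loop_form_neg_twist:
  assumes x: "x \<in> g" and q: "loop_carrier q" and \<mu>: "\<And>\<nu> \<gamma>. \<mu> \<nu> \<gamma> = \<mu> (- \<nu>) (- \<gamma>)"
  shows "loop_form form \<mu> (Poly_Mapping.single (- \<nu>) (\<phi> x)) (neg_twist \<phi> q) =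
    loop_form form \<mu> (Poly_Mapping.single \<nu> x) q"
proof -
  have "qt_eps \<mu> (- \<nu>) (- \<gamma>) = qt_eps \<mu> \<nu> \<gamma>" for \<gamma>
    using \<mu>[of \<nu> \<gamma>] by (auto simp: qt_eps_def)
  then show ?thesis
    using x q
    by (simp add: loop_form_def sum_keys_neg_twist lookup_neg_twist zero form_preserved eq_0_iff)
qed

text \<open>In the central component the value of the form is unchanged while the degree
  \<open>\<iota> \<nu>\<close> is negated, which gives \<open>- u\<close>. The last component of
  every bracket is 0, hence equal to its negative.\<close>

lemma hat_bracket_neg_twist:
  fixes scaleV :: "complex \<Rightarrow> 'v::ab_group_add \<Rightarrow> 'v"
  assumes p: "loop_carrier p" and q: "loop_carrier q"
    and d: "d \<in> dual scaleV UNIV" and e: "e \<in> dual scaleV UNIV"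
    and \<mu>: "\<And>\<nu> \<gamma>. \<mu> \<nu> \<gamma> = \<mu> (- \<nu>) (- \<gamma>)"
    and V: "vector_space scaleV" and \<iota>: "\<And>\<nu>. \<iota> (- \<nu>) = - \<iota> \<nu>"
    and br: "hat_bracket scale br form \<mu> scaleV \<iota> (p, v, d) (q, w, e) = (r, u, f)"
  shows "hat_bracket scale br form \<mu> scaleV \<iota> (neg_twist \<phi> p, - v, - d) (neg_twist \<phi> q, - w, - e) =
    (neg_twist \<phi> r, - u, - f)"
proof -
  interpret V: vector_space scaleV by fact
  have lb: "loop_carrier (loop_bracket scale br \<mu> p q)"
    unfolding loop_bracket_def using p q
    by (intro loop_carrier_sum loop_carrier_single closed_scale br_closed) auto
  have dd: "loop_carrier (degree_derivation scale \<iota> d q)" "loop_carrier (degree_derivation scale \<iota> e p)"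
    using p q by (simp_all add: lookup_degree_derivation closed_scale)
  have r: "r = loop_bracket scale br \<mu> p q + degree_derivation scale \<iota> d q
      - degree_derivation scale \<iota> e p"
    using br by (simp add: hat_bracket_def)
  have "neg_twist \<phi> r = loop_bracket scale br \<mu> (neg_twist \<phi> p) (neg_twist \<phi> q)
      + degree_derivation scale \<iota> (- d) (neg_twist \<phi> q) - degree_derivation scale \<iota> (- e) (neg_twist \<phi> p)"
    unfolding r using lb dd
    by (simp add: neg_twist_add neg_twist_diff lookup_add closed_add
        neg_twist_loop_bracket[where \<mu> = \<mu>, OF p q \<mu>] neg_twist_degree_derivation[where \<iota> = \<iota>, OF q d \<iota>]
        neg_twist_degree_derivation[where \<iota> = \<iota>, OF p e \<iota>])
  moreover have "- u = (\<Sum>\<nu>\<in>Poly_Mapping.keys (neg_twist \<phi> p). scaleV (loop_form form \<mu>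
      (Poly_Mapping.single \<nu> (Poly_Mapping.lookup (neg_twist \<phi> p) \<nu>)) (neg_twist \<phi> q)) (\<iota> \<nu>))"
    using br p
    by (auto simp: hat_bracket_def sum_keys_neg_twist lookup_neg_twist zero \<iota> sum_negf
        loop_form_neg_twist[where \<mu> = \<mu>, OF _ q \<mu>])
  ultimately show ?thesis
    using br by (simp add: hat_bracket_def)
qed

text \<open>Negation of degrees is an involution, so the inverse is the same construction with the
  inverse \<open>\<chi>\<close> of \<open>\<phi>\<close>.\<close>

lemma neg_twist_bij_betw:
  assumes S: "\<And>\<nu>. S \<nu> \<subseteq> g" and \<phi>: "\<And>\<nu>. \<phi> ` S \<nu> = S (- \<nu>)"
  shows "bij_betw (\<lambda>(p, v, d). (neg_twist \<phi> p, - v, - d))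
    (graded_affinization scaleV S) (graded_affinization scaleV S)"
proof -
  define \<chi> where "\<chi> = inv_into g \<phi>"
  have inv: "\<chi> (\<phi> x) = x" if "x \<in> g" for x
    using bij_betw_inv_into_left[OF bij that] by (simp add: \<chi>_def)
  have inv': "\<phi> (\<chi> x) = x" if "x \<in> g" for x
    using bij_betw_inv_into_right[OF bij that] by (simp add: \<chi>_def)
  have \<chi>0: "\<chi> 0 = 0" using inv[OF closed_0] zero by simp
  have \<chi>S: "\<chi> x \<in> S \<nu>" if "x \<in> S (- \<nu>)" for x \<nu>
    using \<phi>[of \<nu>] that S inv by (metis imageE subsetD)
  have \<phi>S: "\<phi> x \<in> S \<nu>" if "x \<in> S (- \<nu>)" for x \<nu>
    using \<phi>[of "- \<nu>"] that by auto
  have Sg: "x \<in> g" if "x \<in> S \<nu>" for x \<nu> using S that by auto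
  show ?thesis
  proof (rule bij_betw_byWitness[where f' = "\<lambda>(p, v, d). (neg_twist \<chi> p, - v, - d)"])
    show "\<forall>a\<in>graded_affinization scaleV S. (case case a of (p, v, d) \<Rightarrow> (neg_twist \<phi> p, - v, - d) of
        (p, v, d) \<Rightarrow> (neg_twist \<chi> p, - v, - d)) = a"
      by (auto simp: graded_affinization_def intro!: neg_twist_inverse[where \<phi> = \<phi> and \<phi>' = \<chi>, OF zero \<chi>0] inv Sg)
    show "\<forall>a\<in>graded_affinization scaleV S. (case case a of (p, v, d) \<Rightarrow> (neg_twist \<chi> p, - v, - d) of
        (p, v, d) \<Rightarrow> (neg_twist \<phi> p, - v, - d)) = a"
      by (auto simp: graded_affinization_def intro!: neg_twist_inverse[where \<phi> = \<chi> and \<phi>' = \<phi>, OF \<chi>0 zero] inv' Sg)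
  qed (auto simp: graded_affinization_def lookup_neg_twist zero \<chi>0 dual_UNIV_uminus \<chi>S \<phi>S)
qed

text \<open>The algebraic identities hold whenever all components lie in \<open>g\<close>; the
  compatibility of \<open>\<phi>\<close> with the grading by \<open>S\<close> is what gives
  bijectivity.\<close>

lemma lie_automorphism_graded_affinization:
  fixes scaleV :: "complex \<Rightarrow> 'v::ab_group_add \<Rightarrow> 'v"
  assumes S: "\<And>\<nu>. S \<nu> \<subseteq> g" and \<phi>: "\<And>\<nu>. \<phi> ` S \<nu> = S (- \<nu>)"
    and \<mu>: "\<And>\<nu> \<gamma>. \<mu> \<nu> \<gamma> = \<mu> (- \<nu>) (- \<gamma>)"
    and V: "vector_space scaleV" and \<iota>: "\<And>\<nu>. \<iota> (- \<nu>) = - \<iota> \<nu>"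
  shows "lie_automorphism (hat_scale scale scaleV) (graded_affinization scaleV S)
    (hat_bracket scale br form \<mu> scaleV \<iota>) (\<lambda>(p, v, d). (neg_twist \<phi> p, - v, - d))"
    (is "lie_automorphism _ ?C ?br ?f")
  unfolding lie_automorphism_def
proof (intro conjI ballI allI)
  interpret V: vector_space scaleV by fact
  show "bij_betw ?f ?C ?C" by (rule neg_twist_bij_betw[where S = S, OF S \<phi>])
  fix a assume "a \<in> ?C"
  then obtain p v d where a: "a = (p, v, d)" "loop_carrier p" "d \<in> dual scaleV UNIV"
    using S by (fastforce simp: graded_affinization_def)
  show "?f (hat_scale scale scaleV c a) = hat_scale scale scaleV c (?f a)" for c
  proof -
    have l: "Poly_Mapping.lookup (\<Sum>\<nu>\<in>Poly_Mapping.keys r. Poly_Mapping.single \<nu>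
        (scale c (Poly_Mapping.lookup r \<nu>))) \<nu> = scale c (Poly_Mapping.lookup r \<nu>)"
      for r :: "'l \<Rightarrow>\<^sub>0 'g" and \<nu>
      by (rule lookup_sum_keys_single[where f = "\<lambda>_. scale c"]) simp
    have "neg_twist \<phi> (\<Sum>\<nu>\<in>Poly_Mapping.keys p. Poly_Mapping.single \<nu> (scale c (Poly_Mapping.lookup p \<nu>)))
      = (\<Sum>\<nu>\<in>Poly_Mapping.keys (neg_twist \<phi> p).
          Poly_Mapping.single \<nu> (scale c (Poly_Mapping.lookup (neg_twist \<phi> p) \<nu>)))"
      using a(2) by (intro poly_mapping_eqI, subst l) (simp add: l lookup_neg_twist zero scaled)
    then show ?thesis by (auto simp: a(1) hat_scale_def)
  qed
  fix b assume "b \<in> ?C"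
  then obtain q w e where b: "b = (q, w, e)" "loop_carrier q" "e \<in> dual scaleV UNIV"
    using S by (fastforce simp: graded_affinization_def)
  show "?f (a + b) = ?f a + ?f b"
    using a b by (simp add: neg_twist_add)
  obtain r u f where "?br a b = (r, u, f)" by (cases "?br a b")
  then show "?f (?br a b) = ?br (?f a) (?f b)"
    using hat_bracket_neg_twist[where \<mu> = \<mu> and \<iota> = \<iota>, OF a(2) b(2) a(3) b(3) \<mu> V \<iota>] a(1) b(1) by simp
qed

end


section \<open>The Chevalley automorphism\<close>

lemma funpow_uminus_twice:
  fixes x :: "'a::group_add"
  shows "(uminus ^^ k) ((uminus ^^ k) x) = x" "(uminus ^^ (k + k)) x = x"
proof -
  show "(uminus ^^ k) ((uminus ^^ k) x) = x"
    by (induction k) (simp_all add: funpow_swap1)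
  then show "(uminus ^^ (k + k)) x = x" by (simp add: funpow_add)
qed

context eala_form_automorphism
begin

lemma lookup_neg_twist_funpow:
  "Poly_Mapping.lookup ((neg_twist \<phi> ^^ n) p) \<nu> = (\<phi> ^^ n) (Poly_Mapping.lookup p ((uminus ^^ n) \<nu>))"
  by (induction n arbitrary: \<nu>) (simp_all add: lookup_neg_twist zero funpow_swap1[of uminus])

lemma affinization_map_funpow:
  "((\<lambda>(p, v, d). (neg_twist \<phi> p, - v, - d)) ^^ n) (p, v, d) =
    ((neg_twist \<phi> ^^ n) p, (uminus ^^ n) v, (uminus ^^ n) d)"
  by (induction n) simp_all

text \<open>A power of the map is tested on elements with a single homogeneous component, which
  shows that the same power of \<open>\<phi>\<close> fixes every \<open>S \<nu>\<close>;
  \<open>gen\<close> then extends this to \<open>g\<close>.\<close>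

lemma finite_order_graded_affinization:
  fixes S :: "'l::ab_group_add \<Rightarrow> 'g set" and scaleV :: "complex \<Rightarrow> 'v::ab_group_add \<Rightarrow> 'v"
  assumes S: "\<And>\<nu>. S \<nu> \<subseteq> g" and S0: "\<And>\<nu>. 0 \<in> S \<nu>"
    and gen: "\<And>x. x \<in> g \<Longrightarrow> \<exists>(y :: nat \<Rightarrow> 'g) I. x = sum y I \<and> (\<forall>i\<in>I. \<exists>\<nu>. y i \<in> S \<nu>)"
  shows "finite_order_on (graded_affinization scaleV S) (\<lambda>(p, v, d). (neg_twist \<phi> p, - v, - d)) \<longleftrightarrow>
    finite_order_on g \<phi>" (is "?L \<longleftrightarrow> ?R")
proof
  assume ?R
  then obtain k where k: "k > 0" "\<And>x. x \<in> g \<Longrightarrow> (\<phi> ^^ k) x = x"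
    by (auto simp: finite_order_on_def)
  \<comment> \<open>The exponent is doubled because the signs on degrees, on V and on its dual
    disappear only in even powers.\<close>
  have twist: "(neg_twist \<phi> ^^ (k + k)) p = p" if p: "loop_carrier p" for p :: "'l \<Rightarrow>\<^sub>0 'g"
  proof (rule poly_mapping_eqI)
    fix \<nu>
    have "(\<phi> ^^ (k + k)) (Poly_Mapping.lookup p \<nu>) = Poly_Mapping.lookup p \<nu>"
      using p k(2) by (simp add: funpow_add)
    then show "Poly_Mapping.lookup ((neg_twist \<phi> ^^ (k + k)) p) \<nu> = Poly_Mapping.lookup p \<nu>"
      by (simp add: lookup_neg_twist_funpow funpow_uminus_twice)
  qed
  show ?L
    unfolding finite_order_on_def
  proof (intro exI[of _ "k + k"] conjI ballI)
    fix a assume "a \<in> graded_affinization scaleV S"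
    then obtain p v d where "a = (p, v, d)" "loop_carrier p"
      using S by (fastforce simp: graded_affinization_def)
    then show "((\<lambda>(p, v, d). (neg_twist \<phi> p, - v, - d)) ^^ (k + k)) a = a"
      by (simp add: affinization_map_funpow twist funpow_uminus_twice)
  qed (use k in simp)
next
  assume ?L
  then obtain k where k: "k > 0"
    and fixed: "\<And>a. a \<in> graded_affinization scaleV S \<Longrightarrow>
      ((\<lambda>(p, v, d). (neg_twist \<phi> p, - v, - d)) ^^ k) a = a"
    by (auto simp: finite_order_on_def)
  interpret \<phi>k: lie_algebra_automorphism scale g br "\<phi> ^^ k" by (rule funpow)
  have homogeneous: "(\<phi> ^^ k) x = x" if x: "x \<in> S \<nu>" for x \<nu>
  proof -
    have "(Poly_Mapping.single \<nu> x, 0, 0) \<in> graded_affinization scaleV S"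
      using x S0 by (auto simp: graded_affinization_def dual_def lookup_single when_def)
    from fixed[OF this] have "(neg_twist \<phi> ^^ k) (Poly_Mapping.single \<nu> x) = Poly_Mapping.single \<nu> x"
      by (simp add: affinization_map_funpow)
    \<comment> \<open>The k-th power moves the single component to the degree
      \<open>(uminus ^^ k) \<nu>\<close>, so both sides are read off there.\<close>
    then have "Poly_Mapping.lookup ((neg_twist \<phi> ^^ k) (Poly_Mapping.single \<nu> x)) ((uminus ^^ k) \<nu>) =
      Poly_Mapping.lookup (Poly_Mapping.single \<nu> x) ((uminus ^^ k) \<nu>)"
      by simp
    then have "(\<phi> ^^ k) x = (x when \<nu> = (uminus ^^ k) \<nu>)"
      by (simp add: lookup_neg_twist_funpow lookup_single funpow_uminus_twice)
    \<comment> \<open>If the degree has moved, the equation says that \<open>\<phi> ^^ k\<close>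
      kills x, so x = 0 by injectivity and the claim is trivial.\<close>
    then show ?thesis
      using \<phi>k.eq_0_iff[of x] S x by (auto simp: when_def split: if_splits)
  qed
  have "(\<phi> ^^ k) x = x" if xg: "x \<in> g" for x
  proof -
    obtain y :: "nat \<Rightarrow> 'g" and I where x: "x = sum y I" and y: "\<And>i. i \<in> I \<Longrightarrow> \<exists>\<nu>. y i \<in> S \<nu>"
      using gen[OF xg] by blast
    have "(\<phi> ^^ k) x = (\<Sum>i\<in>I. (\<phi> ^^ k) (y i))"
      unfolding x by (rule \<phi>k.sum) (use y S in blast)
    also have "\<dots> = x"
      unfolding x by (rule sum.cong[OF refl]) (use y homogeneous in blast)
    finally show ?thesis .
  qed
  then show ?R using k by (auto simp: finite_order_on_def)
qed

end

text \<open>Values of \<open>\<rho>\<close> are representatives in \<open>{0..<int m}\<close>, so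
  negation is respected only as a congruence.\<close>

lemma residue_epimorphism_uminus:
  assumes "residue_epimorphism m \<rho>"
  shows "\<rho> (- \<nu>) mod int m = - \<rho> \<nu> mod int m"
proof -
  have add: "\<rho> (\<kappa> + \<gamma>) = (\<rho> \<kappa> + \<rho> \<gamma>) mod int m" for \<kappa> \<gamma>
    using assms by (simp add: residue_epimorphism_def)
  \<comment> \<open>As \<open>\<rho> 0\<close> is the remainder of its own double, it is divisible
    by m.\<close>
  have "int m dvd \<rho> 0 + \<rho> 0 - \<rho> 0"
    using add[of 0 0] by (metis add_0 dvd_minus_mod)
  then have "(\<rho> \<nu> + \<rho> (- \<nu>)) mod int m = 0"
    using add[of \<nu> "- \<nu>"] add[of 0 0] by (simp add: dvd_eq_mod_eq_0)
  then show ?thesis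
    by (metis add.commute diff_minus_eq_add dvd_eq_mod_eq_0 mod_eq_dvd_iff)
qed

lemma complexification_uminus:
  assumes "complexification scaleV \<iota>"
  shows "\<iota> (- \<nu>) = - \<iota> \<nu>"
proof -
  have add: "\<iota> (\<kappa> + \<gamma>) = \<iota> \<kappa> + \<iota> \<gamma>" for \<kappa> \<gamma>
    using assms by (simp add: complexification_def)
  have "\<iota> 0 = 0" using add[of 0 0] by simp
  then show ?thesis using add[of "- \<nu>" \<nu>] by (simp add: eq_neg_iff_add_eq_0)
qed

section \<open>Sigma-Chevalley pairs and the eigenspaces of \<open>\<sigma>\<close>\<close>

context eala_automorphism
begin

lemma sigma_chevalley_pair_form_automorphism:
  assumes "sigma_chevalley_pair scale g br form h \<sigma> m \<tau> \<psi>"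
  shows "eala_form_automorphism scale g br form h (\<psi> \<circ> \<tau>)"
proof unfold_locales
  have \<tau>: "chevalley_automorphism scale g br h \<tau>" "lie_automorphism scale g br \<tau>"
    and \<psi>: "lie_automorphism scale g br \<psi>" "\<And>x y. x \<in> g \<Longrightarrow> y \<in> g \<Longrightarrow> form (\<psi> x) (\<psi> y) = form x y"
    using assms by (simp_all add: sigma_chevalley_pair_def chevalley_automorphism_def)
  show "lie_automorphism scale g br (\<psi> \<circ> \<tau>)"
    by (rule lie_automorphism_comp[OF \<psi>(1) \<tau>(2)])
  fix x y assume xy: "x \<in> g" "y \<in> g"
  then have "\<tau> x \<in> g" "\<tau> y \<in> g"
    using \<tau>(2) by (auto simp: lie_automorphism_def bij_betw_def)
  then show "form ((\<psi> \<circ> \<tau>) x) ((\<psi> \<circ> \<tau>) y) = form x y"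
    using \<psi>(2) chevalley_automorphism_form[OF \<tau>(1) xy] by simp
qed

text \<open>For the converse inclusion, surjectivity of \<open>\<tau>\<close> gives a preimage in
  \<open>g\<close>, and injectivity cancels \<open>\<tau>\<close> from its eigenvalue
  equation.\<close>

lemma commuting_automorphism_eigenspace:
  assumes aut: "lie_automorphism scale g br \<tau>" and comm: "\<And>x. x \<in> g \<Longrightarrow> \<sigma> (\<tau> x) = \<tau> (\<sigma> x)"
  shows "\<tau> ` eigenspace scale g \<sigma> m j = eigenspace scale g \<sigma> m j"
proof
  interpret \<tau>: lie_algebra_automorphism scale g br \<tau> by unfold_locales (fact aut)
  interpret \<sigma>: lie_algebra_automorphism scale g br \<sigma> by unfold_locales (fact automorphism)
  show "\<tau> ` eigenspace scale g \<sigma> m j \<subseteq> eigenspace scale g \<sigma> m j"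
    by (auto simp: eigenspace_def comm \<tau>.scaled \<tau>.closed)
  show "eigenspace scale g \<sigma> m j \<subseteq> \<tau> ` eigenspace scale g \<sigma> m j"
  proof
    fix y assume y: "y \<in> eigenspace scale g \<sigma> m j"
    then obtain x where x: "x \<in> g" "y = \<tau> x"
      using \<tau>.bij by (auto simp: eigenspace_def bij_betw_def)
    have "\<tau> (\<sigma> x) = \<tau> (scale (exp (2 * of_real pi * \<i> / of_nat m) powi j) x)"
      using y x by (simp add: eigenspace_def comm \<tau>.scaled)
    then have "\<sigma> x = scale (exp (2 * of_real pi * \<i> / of_nat m) powi j) x"
      using \<tau>.bij x(1) \<sigma>.closed closed_scale by (auto simp: bij_betw_def dest: inj_onD)
    then show "y \<in> \<tau> ` eigenspace scale g \<sigma> m j"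
      using x by (auto simp: eigenspace_def)
  qed
qed

lemma sigma_chevalley_pair_eigenspace:
  assumes pair: "sigma_chevalley_pair scale g br form h \<sigma> m \<tau> \<psi>" and \<rho>: "residue_epimorphism m \<rho>"
  shows "(\<psi> \<circ> \<tau>) ` eigenspace scale g \<sigma> m (\<rho> \<nu>) = eigenspace scale g \<sigma> m (\<rho> (- \<nu>))"
proof -
  have "\<tau> ` eigenspace scale g \<sigma> m (\<rho> \<nu>) = eigenspace scale g \<sigma> m (\<rho> \<nu>)"
    using pair
    by (intro commuting_automorphism_eigenspace)
      (auto simp: sigma_chevalley_pair_def chevalley_automorphism_def)
  \<comment> \<open>The condition on \<open>\<psi>\<close> in the pair is stated for the indices
    from 0 to m - 1 only.\<close>
  moreover have "\<rho> \<nu> \<in> {0..<int m}"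
    using \<rho> by (auto simp: residue_epimorphism_def)
  then have "\<psi> ` eigenspace scale g \<sigma> m (\<rho> \<nu>) = eigenspace scale g \<sigma> m (- \<rho> \<nu>)"
    using pair by (simp add: sigma_chevalley_pair_def)
  moreover have "eigenspace scale g \<sigma> m (- \<rho> \<nu>) = eigenspace scale g \<sigma> m (\<rho> (- \<nu>))"
    by (rule eigenspace_cong[OF m_pos]) (simp add: residue_epimorphism_uminus[OF \<rho>])
  ultimately show ?thesis by (metis image_comp)
qed

text \<open>Surjectivity of \<open>\<rho>\<close> realises each index below m as a degree, so the
  eigencomponents of x supply the hypothesis \<open>gen\<close> of the finite order
  criterion.\<close>

lemma sum_of_homogeneous_components:
  assumes \<rho>: "residue_epimorphism m \<rho>" and x: "x \<in> g"
  shows "\<exists>(y :: nat \<Rightarrow> 'a) I. x = sum y I \<and> (\<forall>i\<in>I. \<exists>\<nu>. y i \<in> eigenspace scale g \<sigma> m (\<rho> \<nu>))"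
proof -
  obtain y where y: "\<And>j. y j \<in> eigenspace scale g \<sigma> m (int j)" and sum: "x = (\<Sum>j<m. y j)"
    using finite_order_eigenspace_decomposition[OF automorphism m_pos C1 x] by blast
  have "\<exists>\<nu>. y i \<in> eigenspace scale g \<sigma> m (\<rho> \<nu>)" if "i < m" for i
  proof -
    have "int i \<in> range \<rho>" using \<rho> that by (simp add: residue_epimorphism_def)
    then show ?thesis using y[of i] by (metis imageE)
  qed
  then show ?thesis using sum by blast
qed

end

text \<open>The automorphism property and the action by - 1 on \<open>hat_h\<close> are established
  outright. What remains of the Chevalley property, finite order, is not derived from the orders of
  \<open>\<tau>\<close> and \<open>\<psi>\<close>, which are not assumed to commute; it is shown
  equivalent to finite order of their composite.\<close>

theorem proposition3p26:
  fixes scale :: "complex \<Rightarrow> 'g::ab_group_add \<Rightarrow> 'g"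
    and g h :: "'g set" and br :: "'g \<Rightarrow> 'g \<Rightarrow> 'g" and form :: "'g \<Rightarrow> 'g \<Rightarrow> complex"
    and \<sigma> \<tau> \<psi> :: "'g \<Rightarrow> 'g" and m :: nat
    and \<mu> :: "'l::ab_group_add \<Rightarrow> 'l \<Rightarrow> complex" and \<rho> :: "'l \<Rightarrow> int"
    and scaleV :: "complex \<Rightarrow> 'v::ab_group_add \<Rightarrow> 'v" and \<iota> :: "'l \<Rightarrow> 'v"
  assumes "eala scale g br form h"
    and "eala_automorphism scale g br form h \<sigma> m"
    and "quantum_torus \<mu>"
    and "complexification scaleV \<iota>"
    and "residue_epimorphism m \<rho>"
    and "sigma_chevalley_pair scale g br form h \<sigma> m \<tau> \<psi>"
  shows "(\<forall>x\<in>g. \<forall>(\<nu>::'l) \<gamma>. \<forall>d\<in>dual scaleV UNIV.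
            bar_tau \<tau> \<psi> (Poly_Mapping.single \<nu> x, \<gamma>, d)
              = (Poly_Mapping.single (- \<nu>) (\<psi> (\<tau> x)), - \<gamma>, - d))
    \<and> lie_automorphism (hat_scale scale scaleV) (hat_L scaleV g)
        (hat_bracket scale br form \<mu> scaleV \<iota>) (bar_tau \<tau> \<psi>)
    \<and> lie_automorphism (hat_scale scale scaleV) (hat_L_rho scale scaleV g \<sigma> m \<rho>)
        (hat_bracket scale br form \<mu> scaleV \<iota>) (bar_tau \<tau> \<psi>)
    \<and> (\<forall>k\<in>(hat_h scaleV h \<sigma> :: ('l, 'g, 'v) affinization set). bar_tau \<tau> \<psi> k = - k)
    \<and> (chevalley_automorphism (hat_scale scale scaleV) (hat_L_rho scale scaleV g \<sigma> m \<rho>)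
          (hat_bracket scale br form \<mu> scaleV \<iota>) (hat_h scaleV h \<sigma>) (bar_tau \<tau> \<psi>)
        \<longleftrightarrow> finite_order_on g (\<psi> \<circ> \<tau>))"
proof -
  interpret eala_automorphism scale g br form h \<sigma> m by fact
  interpret \<phi>: eala_form_automorphism scale g br form h "\<psi> \<circ> \<tau>"
    by (rule sigma_chevalley_pair_form_automorphism) fact
  interpret \<sigma>: lie_algebra_automorphism scale g br \<sigma> by unfold_locales (fact automorphism)
  have V: "vector_space scaleV" using assms(4) by (simp add: complexification_def)
  note \<mu> = quantum_torus.minus[OF assms(3)] and \<iota> = complexification_uminus[OF assms(4)]
  let ?E = "\<lambda>\<nu>. eigenspace scale g \<sigma> m (\<rho> \<nu>)"
  have E: "?E \<nu> \<subseteq> g" "0 \<in> ?E \<nu>" for \<nu>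
    by (auto simp: eigenspace_def closed_0 \<sigma>.zero)
  have homogeneous: "\<forall>x\<in>g. \<forall>(\<nu>::'l) \<gamma>. \<forall>d\<in>dual scaleV UNIV.
      bar_tau \<tau> \<psi> (Poly_Mapping.single \<nu> x, \<gamma>, d) = (Poly_Mapping.single (- \<nu>) (\<psi> (\<tau> x)), - \<gamma>, - d)"
    using \<phi>.zero by (simp add: bar_tau_eq neg_twist_single)
  \<comment> \<open>For the constant grading the condition on images is surjectivity of the
    composite on \<open>g\<close>.\<close>
  have hat: "lie_automorphism (hat_scale scale scaleV) (hat_L scaleV g)
      (hat_bracket scale br form \<mu> scaleV \<iota>) (bar_tau \<tau> \<psi>)"
    unfolding hat_L_eq bar_tau_eq
    by (rule \<phi>.lie_automorphism_graded_affinization[where \<mu> = \<mu> and \<iota> = \<iota>, OF _ _ \<mu> V \<iota>])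
      (use \<phi>.bij in \<open>simp_all add: bij_betw_def\<close>)
  have hat_rho: "lie_automorphism (hat_scale scale scaleV) (hat_L_rho scale scaleV g \<sigma> m \<rho>)
      (hat_bracket scale br form \<mu> scaleV \<iota>) (bar_tau \<tau> \<psi>)"
    unfolding hat_L_rho_eq bar_tau_eq
    by (rule \<phi>.lie_automorphism_graded_affinization[where S = ?E and \<mu> = \<mu> and \<iota> = \<iota>, OF E(1) _ \<mu> V \<iota>])
      (rule sigma_chevalley_pair_eigenspace[OF assms(6,5)])
  have cartan: "\<forall>k\<in>(hat_h scaleV h \<sigma> :: ('l, 'g, 'v) affinization set). bar_tau \<tau> \<psi> k = - k"
  proof
    fix a :: "('l, 'g, 'v) affinization" assume "a \<in> hat_h scaleV h \<sigma>"
    then obtain k v d where a: "a = (Poly_Mapping.single 0 k, v, d)" and k: "k \<in> fixed_points h \<sigma>"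
      by (auto simp: hat_h_def)
    interpret \<psi>: lie_algebra_automorphism scale g br \<psi>
      using assms(6) by unfold_locales (simp add: sigma_chevalley_pair_def)
    have kh: "k \<in> h" "k \<in> g" using k h_subset by (auto simp: fixed_points_def)
    \<comment> \<open>Here \<open>\<tau>\<close> negates k because k lies in \<open>h\<close>, and
      \<open>\<psi>\<close> fixes k because k is also fixed by \<open>\<sigma>\<close>.\<close>
    have "\<psi> (\<tau> k) = - k"
      using assms(6) k kh \<psi>.minus by (simp add: sigma_chevalley_pair_def chevalley_automorphism_def)
    then show "bar_tau \<tau> \<psi> a = - a"
      using \<phi>.zero by (simp add: a bar_tau_eq neg_twist_single single_uminus)
  qed
  have order: "finite_order_on (hat_L_rho scale scaleV g \<sigma> m \<rho>) (bar_tau \<tau> \<psi>) \<longleftrightarrow>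
      finite_order_on g (\<psi> \<circ> \<tau>)"
    unfolding hat_L_rho_eq bar_tau_eq
    by (rule \<phi>.finite_order_graded_affinization[where S = ?E, OF E sum_of_homogeneous_components[OF assms(5)]])
  show ?thesis
    using homogeneous hat hat_rho cartan order unfolding chevalley_automorphism_def by blast
qed

end
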